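(* Let $(R,\mathfrak m)$ be a $d$-dimensional analytically unramified Noetherian local ring with $d\ge 1$, and let $J$ be a parameter ideal of $R$. Let $A=R[Jt]=\bigoplus_{n\ge0}J^nt^n$ and $B=\bigoplus_{n\ge0}\overline{J^n}t^n$. If $\operatorname{ht}(A:_AB)=1$, then $$\overline e_1(J)\le\sum_{n\ge1}\lambda\big(\overline{J^n}/J\,\overline{J^{n-1}}\big)+e_1(J).$$
   Context: $R$ is analytically unramified if its $\mathfrak m$-adic completion is reduced. A parameter ideal is an ideal generated by a system of parameters of $R$. $\overline K$ denotes the integral closure of an ideal $K$; $t$ is an indeterminate; $A\subseteq B$ are subrings of $R[t]$, $(A:_AB)=\{a\in A: aB\subseteq A\}$, and $\operatorname{ht}$ is the height of an ideal of $A$. $\lambda$ denotes length as an $R$-module. The functions $n\mapsto\lambda(R/J^{n+1})$ and $n\mapsto\lambda(R/\overline{J^{n+1}})$ agree for $n\gg0$ with polynomials $P_J$ and $\overline P_J$ of degree $d$. Writing a polynomial $Q$ of degree $d$ as $Q=\sum_{i=0}^d(-1)^ie_i(Q)\binom{X+d-i}{d-i}$, one sets $e_1(J)=e_1(P_J)$ and $\overline e_1(J)=e_1(\overline P_J)$. *)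

theory Defs
  imports
    "HOL-Algebra.Ring_Divisibility"
    "HOL-Algebra.Ideal_Product"
    "HOL-Algebra.QuotRing"
    "HOL-Algebra.UnivPoly"
    "HOL-Library.Extended_Real"
    "HOL-Computational_Algebra.Polynomial"
begin

section \<open>Local rings, dimension and height\<close>

definition noetherian_local_ring :: "('a, 'b) ring_scheme \<Rightarrow> 'a set \<Rightarrow> bool" where
  "noetherian_local_ring R \<mm> \<longleftrightarrow>
     cring R \<and> noetherian_ring R \<and> maximalideal \<mm> R \<and> (\<forall>M. maximalideal M R \<longrightarrow> M = \<mm>)"

definition prime_chain :: "('a, 'b) ring_scheme \<Rightarrow> nat \<Rightarrow> (nat \<Rightarrow> 'a set) \<Rightarrow> bool" where
  "prime_chain S n P \<longleftrightarrow> (\<forall>i\<le>n. primeideal (P i) S) \<and> (\<forall>i<n. P i \<subset> P (Suc i))"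

definition krull_dim :: "('a, 'b) ring_scheme \<Rightarrow> enat" where
  "krull_dim S = Sup {enat n | n. \<exists>P. prime_chain S n P}"

definition prime_height :: "('a, 'b) ring_scheme \<Rightarrow> 'a set \<Rightarrow> enat" where
  "prime_height S Q = Sup {enat n | n. \<exists>P. prime_chain S n P \<and> P n = Q}"

text \<open>The unit ideal gets height \<open>\<infinity>\<close> (infimum over the empty set).\<close>

definition ideal_height :: "('a, 'b) ring_scheme \<Rightarrow> 'a set \<Rightarrow> enat" where
  "ideal_height S I = Inf {prime_height S Q | Q. primeideal Q S \<and> I \<subseteq> Q}"


section \<open>Powers, radical and integral closure of ideals\<close>

primrec ideal_power :: "('a, 'b) ring_scheme \<Rightarrow> 'a set \<Rightarrow> nat \<Rightarrow> 'a set" where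
  "ideal_power R I 0 = carrier R"
| "ideal_power R I (Suc n) = ideal_prod R I (ideal_power R I n)"

definition ideal_radical :: "('a, 'b) ring_scheme \<Rightarrow> 'a set \<Rightarrow> 'a set" where
  "ideal_radical R I = {x \<in> carrier R. \<exists>n::nat. x [^]\<^bsub>R\<^esub> n \<in> I}"

definition integral_closure :: "('a, 'b) ring_scheme \<Rightarrow> 'a set \<Rightarrow> 'a set" where
  "integral_closure R K = {x \<in> carrier R. \<exists>n\<ge>(1::nat). \<exists>a.
     (\<forall>i\<in>{1..n}. a i \<in> ideal_power R K i) \<and>
     x [^]\<^bsub>R\<^esub> n \<oplus>\<^bsub>R\<^esub> (\<Oplus>\<^bsub>R\<^esub>i\<in>{1..n}. a i \<otimes>\<^bsub>R\<^esub> x [^]\<^bsub>R\<^esub> (n - i)) = \<zero>\<^bsub>R\<^esub>}"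

text \<open>A system of parameters consists of \<open>dim R\<close> elements of \<open>\<mm>\<close> generating an
  \<open>\<mm>\<close>-primary ideal, i.e. an ideal with radical \<open>\<mm>\<close>.\<close>

definition system_of_parameters :: "('a, 'b) ring_scheme \<Rightarrow> 'a set \<Rightarrow> 'a list \<Rightarrow> bool" where
  "system_of_parameters R \<mm> xs \<longleftrightarrow>
     set xs \<subseteq> \<mm> \<and> enat (length xs) = krull_dim R \<and> ideal_radical R (genideal R (set xs)) = \<mm>"

definition parameter_ideal :: "('a, 'b) ring_scheme \<Rightarrow> 'a set \<Rightarrow> 'a set \<Rightarrow> bool" where
  "parameter_ideal R \<mm> J \<longleftrightarrow> (\<exists>xs. system_of_parameters R \<mm> xs \<and> J = genideal R (set xs))"


section \<open>Completion\<close>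

text \<open>The \<open>I\<close>-adic completion is the inverse limit of the rings \<open>R / I\<^sup>n\<close>. An element is a
  sequence of cosets, and the coset modulo \<open>I\<^sup>n\<^sup>+\<^sup>1\<close> maps to the coset modulo \<open>I\<^sup>n\<close> that contains it.\<close>

definition adic_completion :: "('a, 'b) ring_scheme \<Rightarrow> 'a set \<Rightarrow> (nat \<Rightarrow> 'a set) ring" where
  "adic_completion R I = \<lparr>
     carrier = {x. \<forall>n. x n \<in> carrier (R Quot ideal_power R I n) \<and> x (Suc n) \<subseteq> x n},
     mult = (\<lambda>x y n. x n \<otimes>\<^bsub>R Quot ideal_power R I n\<^esub> y n),
     one = (\<lambda>n. \<one>\<^bsub>R Quot ideal_power R I n\<^esub>),
     zero = (\<lambda>n. \<zero>\<^bsub>R Quot ideal_power R I n\<^esub>),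
     add = (\<lambda>x y n. x n \<oplus>\<^bsub>R Quot ideal_power R I n\<^esub> y n)\<rparr>"

definition reduced_ring :: "('a, 'b) ring_scheme \<Rightarrow> bool" where
  "reduced_ring S \<longleftrightarrow> (\<forall>x\<in>carrier S. \<forall>n::nat. x [^]\<^bsub>S\<^esub> n = \<zero>\<^bsub>S\<^esub> \<longrightarrow> x = \<zero>\<^bsub>S\<^esub>)"

definition analytically_unramified :: "('a, 'b) ring_scheme \<Rightarrow> 'a set \<Rightarrow> bool" where
  "analytically_unramified R \<mm> \<longleftrightarrow> reduced_ring (adic_completion R \<mm>)"


section \<open>Length\<close>

definition module_length ::
    "('r, 'c) ring_scheme \<Rightarrow> ('r, 'a, 'b) module_scheme \<Rightarrow> enat" where
  "module_length R M = Sup {enat n | n. \<exists>N. (\<forall>i\<le>n. submodule (N i) R M) \<and>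
                                            (\<forall>i<n. N i \<subset> N (Suc i))}"

text \<open>The fields \<open>mult\<close> and \<open>one\<close> are only present because module records extend ring
  records; they play no role for modules.\<close>

definition regular_module :: "('a, 'b) ring_scheme \<Rightarrow> ('a, 'a) module" where
  "regular_module R = \<lparr>carrier = carrier R, mult = mult R, one = one R, zero = zero R,
     add = add R, Module.module.smult = mult R\<rparr>"

definition quot_module :: "('r, 'a, 'b) module_scheme \<Rightarrow> 'a set \<Rightarrow> ('r, 'a set) module" where
  "quot_module M N = \<lparr>carrier = a_rcosets\<^bsub>M\<^esub> N, mult = undefined, one = undefined, zero = N,
     add = set_add M, Module.module.smult = (\<lambda>r X. \<Union>x\<in>X. N +>\<^bsub>M\<^esub> (r \<odot>\<^bsub>M\<^esub> x))\<rparr>"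

text \<open>The length of the \<open>R\<close>-module \<open>I / K\<close> for ideals \<open>K \<subseteq> I\<close> of \<open>R\<close>.\<close>

definition quot_length :: "('a, 'b) ring_scheme \<Rightarrow> 'a set \<Rightarrow> 'a set \<Rightarrow> enat" where
  "quot_length R I K = module_length R (quot_module ((regular_module R)\<lparr>carrier := I\<rparr>) K)"


section \<open>Hilbert coefficients\<close>

definition eventual_poly :: "(nat \<Rightarrow> enat) \<Rightarrow> real poly" where
  "eventual_poly f = (THE Q. \<forall>\<^sub>F n in sequentially. ereal_of_enat (f n) = ereal (poly Q (real n)))"

definition binomial_coeffs :: "nat \<Rightarrow> real poly \<Rightarrow> nat \<Rightarrow> real" where
  "binomial_coeffs d Q = (THE e. (\<forall>i>d. e i = 0) \<and>
     (\<forall>x. poly Q x = (\<Sum>i\<le>d. (-1) ^ i * e i * ((x + real (d - i)) gchoose (d - i)))))"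

text \<open>In both of the following, \<open>d\<close> is the dimension of \<open>R\<close>.\<close>

definition e1 :: "('a, 'b) ring_scheme \<Rightarrow> nat \<Rightarrow> 'a set \<Rightarrow> real" where
  "e1 R d J = binomial_coeffs d
     (eventual_poly (\<lambda>n. quot_length R (carrier R) (ideal_power R J (n + 1)))) 1"

definition e1_bar :: "('a, 'b) ring_scheme \<Rightarrow> nat \<Rightarrow> 'a set \<Rightarrow> real" where
  "e1_bar R d J = binomial_coeffs d
     (eventual_poly (\<lambda>n. quot_length R (carrier R) (integral_closure R (ideal_power R J (n + 1))))) 1"


section \<open>Rees algebras and conductors\<close>

text \<open>The subset \<open>\<Oplus> F\<^sub>n t\<^sup>n\<close> of \<open>R[t]\<close>.\<close>

definition graded_subset :: "('a, 'b) ring_scheme \<Rightarrow> (nat \<Rightarrow> 'a set) \<Rightarrow> (nat \<Rightarrow> 'a) set" where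
  "graded_subset R F = {p \<in> carrier (UP R). \<forall>n. up_ring.coeff (UP R) p n \<in> F n}"

definition rees_algebra :: "('a, 'b) ring_scheme \<Rightarrow> 'a set \<Rightarrow> (nat \<Rightarrow> 'a) set" where
  "rees_algebra R J = graded_subset R (ideal_power R J)"

definition integral_rees_algebra :: "('a, 'b) ring_scheme \<Rightarrow> 'a set \<Rightarrow> (nat \<Rightarrow> 'a) set" where
  "integral_rees_algebra R J = graded_subset R (\<lambda>n. integral_closure R (ideal_power R J n))"

definition conductor :: "('a, 'b) ring_scheme \<Rightarrow> 'a set \<Rightarrow> 'a set \<Rightarrow> 'a set" where
  "conductor S A B = {a \<in> A. \<forall>b\<in>B. a \<otimes>\<^bsub>S\<^esub> b \<in> A}"

end

(*
  If the sum is finite, then F_(n+1) = J F_n for large n, where F_n denotes the integral closure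
  of J^n, so both Hilbert functions are, up to a shift, of the form n |-> l(M/J^n M) for an ideal M.
  Refining the chain F_(n+1) >= J F_n >= J^2 F_(n-1) >= ... >= J^(n+1) and using that J^i is
  generated by binom(i+d-1, d-1) monomials in the parameters, one gets

    0 <= l(R/J^(n+1)) - l(R/F_(n+1)) <= binom(n+d-1, d-1) * (sum of l(F_m / J F_(m-1)) over m >= 1).

  Comparing the coefficients of the two polynomials in the binomial basis first shows that e_0 is
  the same for both and then gives the claim about e_1.

  The Hilbert polynomials come from a Groebner-style argument that avoids graded modules: filter
  J^n M by the monomials of degree n in lexicographic order.  The quotients are M / L(alpha), where
  L is a monotone function from exponent vectors to ideals, so Dickson's lemma and the ascending
  chain condition make the sum of their lengths over |alpha| = n eventually polynomial.  The same
  stabilization replaces the determinant trick in the proof that integral closures are ideals.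
*)

theory Submission
  imports Defs "HOL-Library.List_Lexorder"
begin

section \<open>Monotone functions on exponent vectors\<close>

text \<open>Lengths are handled as suprema, in \<open>enat\<close>, of chains of ideals between
  \<open>K\<close> and \<open>I\<close>. Additivity then holds without any finiteness and without
  composition series, and real numbers enter only once finiteness is known. The obstacle in the
  Groebner-style argument is uniformity: for each fixed tail of an exponent vector the ideals
  stabilize as the first coordinate grows, but the index might depend on the tail. Dickson's lemma
  supplies one index for all tails, and this lets an infinite family of slices be summed as a single
  function. For integral closures, an equation of integral dependence behaves badly under addition.
  It is traded for a growth condition: x is integral over K iff, for some c, x^m lies in K^(m-c) for
  all m. Sums and products are easy in this form; the way back to an equation is where stabilization
  enters, with the number of allowed powers of x as one more coordinate. In the basis binom(n+i, i)
  the coefficient of index d-1 is -e_1. This sign turns an upper bound for l(R/J^(n+1)) -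
  l(R/F_(n+1)) into an upper bound for e_1 of the closures minus e_1(J).\<close>

definition exponents :: "nat \<Rightarrow> nat \<Rightarrow> nat list set" where
  "exponents d n = {\<alpha>. length \<alpha> = d \<and> sum_list \<alpha> = n}"

text \<open>A monotone subsequence may be decreasing; in the natural numbers it then becomes
  constant, and its tail from the minimum on serves instead.\<close>

lemma nat_mono_subseq:
  fixes h :: "nat \<Rightarrow> nat"
  shows "\<exists>r :: nat \<Rightarrow> nat. strict_mono r \<and> mono (h \<circ> r)"
proof -
  obtain f where f: "strict_mono f" "monoseq (\<lambda>n. h (f n))"
    using seq_monosub[of h] by blast
  show ?thesis
  proof (cases "mono (\<lambda>n. h (f n))")
    case True
    then show ?thesis using f(1) unfolding o_def by blast
  next
    case False
    then have dec: "h (f n) \<le> h (f m)" if "m \<le> n" for m n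
      using f(2) that unfolding monoseq_def mono_def by blast
    obtain N where N: "\<And>n. h (f N) \<le> h (f n)"
      using ex_has_least_nat[of "\<lambda>_. True" 0 "\<lambda>n. h (f n)"] by auto
    have const: "h (f (n + N)) = h (f N)" for n
      using N[of "n + N"] dec[of N "n + N"] by simp
    have "strict_mono (\<lambda>n. f (n + N))"
      using f(1) by (auto simp: strict_mono_def)
    moreover have "mono (h \<circ> (\<lambda>n. f (n + N)))"
      by (simp add: mono_def const)
    ultimately show ?thesis by blast
  qed
qed

text \<open>An infinite ascending subsequence, rather than one comparable pair, is the form that
  survives the induction on the length: a subsequence ascending in the tails is thinned once more to
  ascend in the heads.\<close>

lemma dickson:
  fixes s :: "nat \<Rightarrow> nat list"
  assumes "\<And>k. length (s k) = d"
  shows "\<exists>r :: nat \<Rightarrow> nat. strict_mono r \<and> (\<forall>i j. i \<le> j \<longrightarrow> list_all2 (\<le>) (s (r i)) (s (r j)))"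
  using assms
proof (induction d arbitrary: s)
  case 0
  then have "s k = []" for k by simp
  then show ?case by (simp add: exI[of _ id] strict_mono_id)
next
  case (Suc d)
  obtain p :: "nat \<Rightarrow> nat" where p: "strict_mono p"
    "\<And>i j. i \<le> j \<Longrightarrow> list_all2 (\<le>) (tl (s (p i))) (tl (s (p j)))"
    using Suc.IH[of "\<lambda>k. tl (s k)"] Suc.prems by auto
  obtain q :: "nat \<Rightarrow> nat" where q: "strict_mono q" "mono ((\<lambda>k. hd (s (p k))) \<circ> q)"
    using nat_mono_subseq by blast
  have cons: "s k = hd (s k) # tl (s k)" for k
    using Suc.prems[of k] by (cases "s k") auto
  have "list_all2 (\<le>) (s (p (q i))) (s (p (q j)))" if "i \<le> j" for i j
  proof -
    have "hd (s (p (q i))) \<le> hd (s (p (q j)))"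
      using q(2) that by (simp add: mono_def)
    moreover have "q i \<le> q j"
      using q(1) that by (simp add: strict_mono_less_eq)
    ultimately show ?thesis
      using p(2)[of "q i" "q j"] cons by (metis list.rel_intros(2))
  qed
  moreover have "strict_mono (p \<circ> q)"
    using p(1) q(1) by (simp add: strict_mono_o)
  ultimately show ?case by (intro exI[of _ "p \<circ> q"] conjI) (simp_all add: o_def)
qed

lemma list_all2_le_refl: "list_all2 (\<le>) \<alpha> (\<alpha> :: nat list)"
  by (simp add: list_all2_refl)

text \<open>The gain is that \<open>k0\<close> serves all \<open>\<alpha>\<close> at once. If no
  \<open>k0\<close> does, every \<open>k\<close> has a witness \<open>A k\<close> at which
  \<open>f\<close> still grows up to first coordinate \<open>K k\<close>. Iterating \<open>K\<close>
  gives heads \<open>\<kappa> i\<close>, and along a subsequence on which the tails ascend the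
  values of \<open>f\<close> increase strictly forever.\<close>

lemma uniform_stabilization:
  fixes f :: "nat list \<Rightarrow> 'x::order"
  assumes mono: "\<And>\<alpha> \<beta>. length \<alpha> = Suc d \<Longrightarrow> list_all2 (\<le>) \<alpha> \<beta> \<Longrightarrow> f \<alpha> \<le> f \<beta>"
    and acc: "\<And>g. (\<And>i. length (g i) = Suc d) \<Longrightarrow> \<not> (\<forall>i::nat. f (g i) < f (g (Suc i)))"
  shows "\<exists>k0. \<forall>k \<alpha>. k0 \<le> k \<longrightarrow> length \<alpha> = d \<longrightarrow> f (k # \<alpha>) = f (k0 # \<alpha>)"
proof (rule ccontr)
  assume "\<not> ?thesis"
  then have "\<forall>k0. \<exists>k \<alpha>. k0 \<le> k \<and> length \<alpha> = d \<and> f (k # \<alpha>) \<noteq> f (k0 # \<alpha>)"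
    by meson
  then obtain K A where KA: "\<And>k0. k0 \<le> K k0 \<and> length (A k0) = d \<and> f (K k0 # A k0) \<noteq> f (k0 # A k0)"
    by metis
  have less: "f (k # A k) < f (K k # A k)" for k
    using KA[of k] mono[of "k # A k" "K k # A k"] by (auto simp: less_le list_all2_le_refl)
  define \<kappa> where "\<kappa> = (\<lambda>i. (K ^^ i) 0)"
  have \<kappa>: "mono \<kappa>"
    by (rule incseq_SucI) (use KA in \<open>auto simp: \<kappa>_def\<close>)
  obtain r :: "nat \<Rightarrow> nat" where r: "strict_mono r"
    "\<And>i j. i \<le> j \<Longrightarrow> list_all2 (\<le>) (A (\<kappa> (r i))) (A (\<kappa> (r j)))"
    using dickson[of "\<lambda>i. A (\<kappa> i)" d] KA by auto
  have "f (\<kappa> (r i) # A (\<kappa> (r i))) < f (\<kappa> (r (Suc i)) # A (\<kappa> (r (Suc i))))" for i :: nat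
  proof -
    \<comment> \<open>\<open>K (\<kappa> j)\<close> is \<open>\<kappa> (Suc j)\<close>, so the next
      member of the subsequence has a head at least as large as the one at which \<open>f\<close>
      has grown.\<close>
    have "Suc (r i) \<le> r (Suc i)"
      using strict_monoD[OF r(1), of i "Suc i"] by simp
    then have "K (\<kappa> (r i)) \<le> \<kappa> (r (Suc i))"
      using monoD[OF \<kappa>, of "Suc (r i)" "r (Suc i)"] by (simp add: \<kappa>_def)
    then have "f (K (\<kappa> (r i)) # A (\<kappa> (r i))) \<le> f (\<kappa> (r (Suc i)) # A (\<kappa> (r (Suc i))))"
      using KA r(2) by (intro mono) auto
    then show ?thesis using less[of "\<kappa> (r i)"] by (rule less_le_trans[rotated])
  qed
  moreover have "length (\<kappa> (r i) # A (\<kappa> (r i))) = Suc d" for i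
    using KA by simp
  ultimately show False
    using acc[of "\<lambda>i. \<kappa> (r i) # A (\<kappa> (r i))"] by blast
qed

lemma finite_exponents: "finite (exponents d n)"
proof -
  have "exponents d n \<subseteq> {\<alpha>. set \<alpha> \<subseteq> {..n} \<and> length \<alpha> = d}"
    by (auto simp: exponents_def dest: member_le_sum_list)
  then show ?thesis
    by (rule finite_subset) (simp add: finite_lists_length_eq)
qed

lemma sum_exponents_Suc:
  fixes g :: "nat list \<Rightarrow> real"
  shows "(\<Sum>\<alpha>\<in>exponents (Suc d) n. g \<alpha>) = (\<Sum>k\<le>n. \<Sum>\<alpha>\<in>exponents d (n - k). g (k # \<alpha>))"
proof -
  have "exponents (Suc d) n = (\<lambda>(k, \<alpha>). k # \<alpha>) ` (SIGMA k:{..n}. exponents d (n - k))"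
    by (auto simp: exponents_def image_iff length_Suc_conv)
  then have "(\<Sum>\<alpha>\<in>exponents (Suc d) n. g \<alpha>)
      = (\<Sum>(k, \<alpha>)\<in>(SIGMA k:{..n}. exponents d (n - k)). g (k # \<alpha>))"
    by (simp add: sum.reindex inj_on_def case_prod_unfold)
  then show ?thesis
    by (simp add: sum.Sigma finite_exponents)
qed


section \<open>Eventually polynomial functions in the binomial basis\<close>

text \<open>Eventually a polynomial of degree less than \<open>d\<close> (zero for
  \<open>d = 0\<close>). In this basis summation over initial segments is a shift of the index by
  one, and Hilbert coefficients can be read off directly.\<close>

definition ev_binomial :: "nat \<Rightarrow> (nat \<Rightarrow> real) \<Rightarrow> bool" where
  "ev_binomial d h \<longleftrightarrow>
     (\<exists>c. \<forall>\<^sub>F n in sequentially. h n = (\<Sum>i<d. c i * real ((n + i) choose i)))"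

lemma ev_binomial_cong:
  assumes "ev_binomial d h" "\<forall>\<^sub>F n in sequentially. g n = h n"
  shows "ev_binomial d g"
  proof -
  obtain c where "\<forall>\<^sub>F n in sequentially. h n = (\<Sum>i<d. c i * real ((n + i) choose i))"
    using assms(1) unfolding ev_binomial_def by blast
  with assms(2) have "\<forall>\<^sub>F n in sequentially. g n = (\<Sum>i<d. c i * real ((n + i) choose i))"
    by eventually_elim simp
  then show ?thesis unfolding ev_binomial_def by (intro exI[of _ c])
qed

lemma ev_binomial_add:
  assumes "ev_binomial d g" "ev_binomial d h"
  shows "ev_binomial d (\<lambda>n. g n + h n)"
proof -
  obtain b c where
    "\<forall>\<^sub>F n in sequentially. g n = (\<Sum>i<d. b i * real ((n + i) choose i))"
    "\<forall>\<^sub>F n in sequentially. h n = (\<Sum>i<d. c i * real ((n + i) choose i))"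
    using assms unfolding ev_binomial_def by blast
  then have "\<forall>\<^sub>F n in sequentially. g n + h n = (\<Sum>i<d. (b i + c i) * real ((n + i) choose i))"
    by eventually_elim (simp add: algebra_simps sum.distrib)
  then show ?thesis unfolding ev_binomial_def by (intro exI[of _ "\<lambda>i. b i + c i"])
qed

lemma ev_binomial_scale:
  assumes "ev_binomial d h"
  shows "ev_binomial d (\<lambda>n. a * h n)"
proof -
  obtain c where "\<forall>\<^sub>F n in sequentially. h n = (\<Sum>i<d. c i * real ((n + i) choose i))"
    using assms unfolding ev_binomial_def by blast
  then have "\<forall>\<^sub>F n in sequentially. a * h n = (\<Sum>i<d. (a * c i) * real ((n + i) choose i))"
    by eventually_elim (simp add: sum_distrib_left mult.assoc)
  then show ?thesis unfolding ev_binomial_def by (intro exI[of _ "\<lambda>i. a * c i"])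
qed

lemma ev_binomial_zero: "ev_binomial d (\<lambda>_. 0)"
  unfolding ev_binomial_def by (intro exI[of _ "\<lambda>_. 0"]) simp

lemma ev_binomial_sum:
  assumes "\<And>i. i \<in> I \<Longrightarrow> ev_binomial d (h i)"
  shows "ev_binomial d (\<lambda>n. \<Sum>i\<in>I. h i n)"
  using assms by (induction I rule: infinite_finite_induct)
    (auto intro: ev_binomial_zero ev_binomial_add)

lemma ev_binomial_basis:
  assumes "i < d"
  shows "ev_binomial d (\<lambda>n. real ((n + i) choose i))"
proof -
  have "(\<Sum>j<d. (if j = i then 1 else 0) * real ((n + j) choose j)) = real ((n + i) choose i)" for n
    using assms by (simp add: if_distrib[of "\<lambda>x. x * _"] cong: if_cong)
  then show ?thesis
    unfolding ev_binomial_def by (intro exI[of _ "\<lambda>j. if j = i then 1 else 0"]) simp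
qed

lemma ev_binomial_const:
  assumes "0 < d" shows "ev_binomial d (\<lambda>_. a)"
  using ev_binomial_scale[OF ev_binomial_basis[OF assms], of a] by simp

lemma ev_binomial_Suc:
  assumes "ev_binomial d h"
  shows "ev_binomial (Suc d) h"
proof -
  obtain c where c: "\<forall>\<^sub>F n in sequentially. h n = (\<Sum>i<d. c i * real ((n + i) choose i))"
    using assms unfolding ev_binomial_def by blast
  have "ev_binomial (Suc d) (\<lambda>n. \<Sum>i<d. c i * real ((n + i) choose i))"
    by (intro ev_binomial_sum ev_binomial_scale ev_binomial_basis) auto
  then show ?thesis using c by (rule ev_binomial_cong)
qed

lemma ev_binomial_diff_nat:
  assumes "ev_binomial d h"
  shows "ev_binomial d (\<lambda>n. h (n - k))"
proof -
  have step: "ev_binomial d (\<lambda>n. g (n - 1))" if g: "ev_binomial d g" for g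
  proof -
    obtain c where c: "\<forall>\<^sub>F n in sequentially. g n = (\<Sum>i<d. c i * real ((n + i) choose i))"
      using g unfolding ev_binomial_def by blast
    have "ev_binomial d (\<lambda>n. real ((n - 1 + i) choose i))" if "i < d" for i
    proof (cases i)
      case 0
      then show ?thesis using that by (simp add: ev_binomial_const)
    next
      case (Suc j)
      \<comment> \<open>Pascal's rule: binom(n-1+i, i) = binom(n+i, i) - binom(n+j, j) for i = j+1.
        Truncated subtraction makes it fail at n = 0, so the equality is claimed only
        eventually.\<close>
      have "ev_binomial d (\<lambda>n. real ((n + i) choose i) + (- 1) * real ((n + j) choose j))"
        using that Suc by (intro ev_binomial_add ev_binomial_scale ev_binomial_basis) auto
      moreover have "\<forall>\<^sub>F n in sequentially. real ((n - 1 + i) choose i)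
          = real ((n + i) choose i) + (- 1) * real ((n + j) choose j)"
        using eventually_gt_at_top[of 0] by eventually_elim (auto simp: Suc gr0_conv_Suc)
      ultimately show ?thesis by (rule ev_binomial_cong)
    qed
    then have "ev_binomial d (\<lambda>n. \<Sum>i<d. c i * real ((n - 1 + i) choose i))"
      by (intro ev_binomial_sum ev_binomial_scale) auto
    moreover have "filterlim (\<lambda>n::nat. n - 1) sequentially sequentially"
      by (rule filterlim_minus_const_nat_at_top)
    then have "\<forall>\<^sub>F n in sequentially. g (n - 1) = (\<Sum>i<d. c i * real ((n - 1 + i) choose i))"
      using c by (rule eventually_compose_filterlim[rotated])
    ultimately show ?thesis by (rule ev_binomial_cong)
  qed
  show ?thesis
  proof (induction k)
    case 0
    then show ?case using assms by simp
  next
    case (Suc k)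
    from step[OF this] show ?case by (simp add: diff_commute)
  qed
qed

lemma ev_binomial_partial_sums:
  assumes "ev_binomial d h"
  shows "ev_binomial (Suc d) (\<lambda>n. \<Sum>j\<le>n. h j)"
proof -
  obtain c N where c: "\<And>n. n \<ge> N \<Longrightarrow> h n = (\<Sum>i<d. c i * real ((n + i) choose i))"
    using assms unfolding ev_binomial_def eventually_sequentially by blast
  define p where "p = (\<lambda>n. \<Sum>i<d. c i * real ((n + i) choose i))"
  \<comment> \<open>\<open>h\<close> differs from its binomial expression only below
    \<open>N\<close>. The total \<open>C\<close> of these differences goes into the coefficient of
    index 0, and the hockey-stick identity moves the others from \<open>i\<close> to
    \<open>Suc i\<close>.\<close>
  define C where "C = (\<Sum>j<N. h j - p j)"
  have sum_p: "(\<Sum>j\<le>n. p j) = (\<Sum>i<d. c i * real ((n + Suc i) choose Suc i))" for n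
  proof -
    have "(\<Sum>j\<le>n. p j) = (\<Sum>i<d. c i * (\<Sum>j\<le>n. real ((j + i) choose i)))"
      unfolding p_def by (subst sum.swap) (simp add: sum_distrib_left)
    moreover have "(\<Sum>j\<le>n. real ((j + i) choose i)) = real ((n + Suc i) choose Suc i)" for i
      using choose_rising_sum(1)[of i n] by (simp add: add.commute flip: of_nat_sum)
    ultimately show ?thesis by simp
  qed
  have "(\<Sum>j\<le>n. h j) = C + (\<Sum>j\<le>n. p j)" if "n \<ge> N" for n
  proof -
    have "(\<Sum>j\<le>n. h j - p j) = C"
      unfolding C_def using that c by (intro sum.mono_neutral_right) (auto simp: p_def)
    then show ?thesis by (simp add: sum_subtractf)
  qed
  then have "\<forall>\<^sub>F n in sequentially. (\<Sum>j\<le>n. h j)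
      = C + (\<Sum>i<d. c i * real ((n + Suc i) choose Suc i))"
    unfolding sum_p eventually_sequentially by blast
  moreover have "ev_binomial (Suc d) (\<lambda>n. C + (\<Sum>i<d. c i * real ((n + Suc i) choose Suc i)))"
    by (intro ev_binomial_add ev_binomial_const ev_binomial_sum ev_binomial_scale ev_binomial_basis)
      auto
  ultimately show ?thesis by (blast intro: ev_binomial_cong)
qed

text \<open>From the uniform index \<open>k0\<close> on, all slices with a fixed first coordinate
  are the same function, so together they form a partial sum, which costs one degree; the finitely
  many slices below \<open>k0\<close> are covered by the induction hypothesis. \<open>f\<close> and
  its weight \<open>w\<close> are kept apart because the chain condition concerns the ideals and not
  their lengths.\<close>

lemma ev_binomial_exponents:
  fixes f :: "nat list \<Rightarrow> 'x::order" and w :: "'x \<Rightarrow> real"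
  assumes "\<And>\<alpha> \<beta>. length \<alpha> = d \<Longrightarrow> list_all2 (\<le>) \<alpha> \<beta> \<Longrightarrow> f \<alpha> \<le> f \<beta>"
    and "\<And>g. (\<And>i. length (g i) = d) \<Longrightarrow> \<not> (\<forall>i::nat. f (g i) < f (g (Suc i)))"
  shows "ev_binomial d (\<lambda>n. \<Sum>\<alpha>\<in>exponents d n. w (f \<alpha>))"
  using assms
proof (induction d arbitrary: f)
  case 0
  have "\<forall>\<^sub>F n in sequentially. (\<Sum>\<alpha>\<in>exponents 0 n. w (f \<alpha>)) = 0"
    using eventually_gt_at_top[of 0]
  proof eventually_elim
    case (elim n)
    then have "exponents 0 n = {}" by (auto simp: exponents_def)
    then show ?case by simp
  qed
  then show ?case by (rule ev_binomial_cong[OF ev_binomial_zero])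
next
  case (Suc d)
  define H where "H = (\<lambda>k n. \<Sum>\<alpha>\<in>exponents d n. w (f (k # \<alpha>)))"
  have H: "ev_binomial d (H k)" for k
    unfolding H_def
  proof (rule Suc.IH)
    show "f (k # \<alpha>) \<le> f (k # \<beta>)" if "length \<alpha> = d" "list_all2 (\<le>) \<alpha> \<beta>" for \<alpha> \<beta>
      using that by (intro Suc.prems(1)) auto
    show "\<not> (\<forall>i::nat. f (k # g i) < f (k # g (Suc i)))" if "\<And>i. length (g i) = d" for g
      using that by (intro Suc.prems(2)) auto
  qed
  have "\<exists>k0. \<forall>k \<alpha>. k0 \<le> k \<longrightarrow> length \<alpha> = d \<longrightarrow> f (k # \<alpha>) = f (k0 # \<alpha>)"
  proof (rule uniform_stabilization)
    show "f \<alpha> \<le> f \<beta>" if "length \<alpha> = Suc d" "list_all2 (\<le>) \<alpha> \<beta>" for \<alpha> \<beta>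
      using that by (rule Suc.prems(1))
    show "\<not> (\<forall>i::nat. f (g i) < f (g (Suc i)))" if "\<And>i. length (g i) = Suc d" for g
      using that by (rule Suc.prems(2))
  qed
  then obtain k0 where k0: "\<And>k \<alpha>. k0 \<le> k \<Longrightarrow> length \<alpha> = d \<Longrightarrow> f (k # \<alpha>) = f (k0 # \<alpha>)"
    by blast
  have H_k0: "H k = H k0" if "k0 \<le> k" for k
    unfolding H_def using k0[OF that] by (intro ext sum.cong) (auto simp: exponents_def)
  have "(\<Sum>\<alpha>\<in>exponents (Suc d) n. w (f \<alpha>)) = (\<Sum>k<k0. H k (n - k)) + (\<Sum>j\<le>n - k0. H k0 j)"
    if "k0 \<le> n" for n
  proof -
    have "(\<Sum>\<alpha>\<in>exponents (Suc d) n. w (f \<alpha>)) = (\<Sum>k\<le>n. H k (n - k))"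
      by (simp add: sum_exponents_Suc H_def)
    also have "\<dots> = (\<Sum>k\<in>{..<k0} \<union> {k0..n}. H k (n - k))"
      using that by (intro sum.cong) auto
    also have "\<dots> = (\<Sum>k<k0. H k (n - k)) + (\<Sum>k=k0..n. H k (n - k))"
      by (rule sum.union_disjoint) auto
    also have "(\<Sum>k=k0..n. H k (n - k)) = (\<Sum>k=k0..n. H k0 (n - k))"
    proof (rule sum.cong)
      fix k assume "k \<in> {k0..n}"
      then show "H k (n - k) = H k0 (n - k)" using H_k0[of k] by (metis atLeastAtMost_iff)
    qed simp
    also have "(\<Sum>k=k0..n. H k0 (n - k)) = (\<Sum>j\<le>n - k0. H k0 j)"
      by (rule sum.reindex_bij_witness[of _ "\<lambda>j. n - j" "\<lambda>k. n - k"]) (use that in auto)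
    finally show ?thesis .
  qed
  then have "\<forall>\<^sub>F n in sequentially. (\<Sum>\<alpha>\<in>exponents (Suc d) n. w (f \<alpha>))
      = (\<Sum>k<k0. H k (n - k)) + (\<Sum>j\<le>n - k0. H k0 j)"
    unfolding eventually_sequentially by blast
  moreover have "ev_binomial (Suc d) (\<lambda>n. (\<Sum>k<k0. H k (n - k)) + (\<Sum>j\<le>n - k0. H k0 j))"
    by (rule ev_binomial_add[OF _ ev_binomial_diff_nat[OF ev_binomial_partial_sums[OF H]]])
      (intro ev_binomial_sum ev_binomial_Suc ev_binomial_diff_nat H)
  ultimately show ?case by (blast intro: ev_binomial_cong)
qed

section \<open>Growth and independence of the binomial basis\<close>

lemma binomial_ratio_tendsto_0:
  assumes "i < j"
  shows "(\<lambda>n. real ((n + i) choose i) / real ((n + j) choose j)) \<longlonglongrightarrow> 0"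
proof -
  \<comment> \<open>For neighbouring indices the ratio equals (k+1)/(n+k+1); general indices follow
    by a product of such ratios.\<close>
  have step: "(\<lambda>n. real ((n + k) choose k) / real ((n + Suc k) choose Suc k)) \<longlonglongrightarrow> 0" for k
  proof -
    have "real ((n + k) choose k) / real ((n + Suc k) choose Suc k) = real (Suc k) * inverse (real (Suc (n + k)))" for n
    proof -
      have "real (Suc k) * real ((n + Suc k) choose Suc k) = real (Suc (n + k)) * real ((n + k) choose k)"
        using Suc_times_binomial_eq[of "n + k" k] by (metis add_Suc_right mult.commute of_nat_mult)
      moreover have "0 < real ((n + Suc k) choose Suc k)"
        by (simp only: of_nat_0_less_iff) (rule zero_less_binomial, simp)
      ultimately show ?thesis by (simp add: field_simps del: binomial_Suc_Suc of_nat_Suc)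
    qed
    moreover have "(\<lambda>n. real (Suc k) * inverse (real (Suc (n + k)))) \<longlonglongrightarrow> 0"
      using LIMSEQ_ignore_initial_segment[OF LIMSEQ_inverse_real_of_nat, of k]
      by (rule tendsto_mult_right_zero)
    ultimately show ?thesis by simp
  qed
  show ?thesis
    using assms
  proof (induction j)
    case (Suc j)
    show ?case
    proof (cases "i = j")
      case False
      have "(\<lambda>n. (real ((n + i) choose i) / real ((n + j) choose j))
          * (real ((n + j) choose j) / real ((n + Suc j) choose Suc j))) \<longlonglongrightarrow> 0 * 0"
        using Suc False by (intro tendsto_mult step) auto
      moreover have "real ((n + j) choose j) \<noteq> 0" for n by simp
      ultimately show ?thesis by (simp del: binomial_Suc_Suc)
    qed (use step in blast)
  qed simp
qed

text \<open>Division by binom(n+D, D) leaves the coefficient of index \<open>D\<close> as the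
  limit.\<close>

lemma leading_coeff_nonpos:
  assumes "\<forall>\<^sub>F n in sequentially. (\<Sum>i\<le>D. a i * real ((n + i) choose i)) \<le> 0"
  shows "a D \<le> 0"
proof -
  have "(\<lambda>n. a i * (real ((n + i) choose i) / real ((n + D) choose D)))
      \<longlonglongrightarrow> (if i = D then a D else 0)" if "i \<le> D" for i
  proof (cases "i = D")
    case True
    have "real ((n + D) choose D) \<noteq> 0" for n by simp
    then show ?thesis using True by simp
  next
    case False
    then show ?thesis
      using that binomial_ratio_tendsto_0[of i D] by (simp only: if_False) (intro tendsto_mult_right_zero, simp)
  qed
  then have "(\<lambda>n. \<Sum>i\<le>D. a i * (real ((n + i) choose i) / real ((n + D) choose D)))
      \<longlonglongrightarrow> (\<Sum>i\<le>D. if i = D then a D else 0)"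
    by (intro tendsto_sum) auto
  then have lim: "(\<lambda>n. \<Sum>i\<le>D. a i * (real ((n + i) choose i) / real ((n + D) choose D))) \<longlonglongrightarrow> a D"
    by simp
  have "\<forall>\<^sub>F n in sequentially. (\<Sum>i\<le>D. a i * (real ((n + i) choose i) / real ((n + D) choose D))) \<le> 0"
    using assms
  proof eventually_elim
    case (elim n)
    have "(\<Sum>i\<le>D. a i * (real ((n + i) choose i) / real ((n + D) choose D)))
        = (\<Sum>i\<le>D. a i * real ((n + i) choose i)) / real ((n + D) choose D)"
      by (simp add: sum_divide_distrib)
    then show ?case using elim by (simp add: divide_le_0_iff)
  qed
  with lim show ?thesis
    by (intro tendsto_upperbound) auto
qed

lemma poly_gbinomial_shift:
  "\<exists>p :: real poly. \<forall>x. poly p x = (x + real i) gchoose i"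
proof (induction i)
  case 0
  show ?case by (intro exI[of _ 1]) simp
next
  case (Suc i)
  then obtain p :: "real poly" where p: "\<And>x. poly p x = (x + real i) gchoose i" by blast
  have "(x + real (Suc i)) gchoose Suc i = (x + real i + 1) / real (Suc i) * ((x + real i) gchoose i)" for x
    using gbinomial_factors[of "x + real i" i] by (simp add: algebra_simps)
  then have "\<forall>x. poly (smult (1 / real (Suc i)) ([:real i + 1, 1:] * p)) x = (x + real (Suc i)) gchoose Suc i"
    by (simp add: p field_simps)
  then show ?case by blast
qed

text \<open>Evaluation at x = -1-k turns the basis element of index i into (-1)^i binom(k, i), which
  vanishes for i > k. The linear system is triangular, and the coefficients vanish one after
  another.\<close>

lemma gbinomial_shift_independent:
  fixes b :: "nat \<Rightarrow> real"
  assumes "\<And>x::real. (\<Sum>i\<le>d. b i * ((x + real i) gchoose i)) = 0" and "k \<le> d"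
  shows "b k = 0"
  using \<open>k \<le> d\<close>
proof (induction k rule: less_induct)
  case (less k)
  have val: "((- 1 - real k) + real i) gchoose i = (- 1) ^ i * real (k choose i)" for i
  proof -
    have "(- 1 - real k) + real i = - (real k + 1 - real i)" by simp
    then show ?thesis
      using gbinomial_minus[of "real k + 1 - real i" i]
      by (simp only: binomial_gbinomial) simp
  qed
  have "0 = (\<Sum>i\<le>d. b i * ((- 1) ^ i * real (k choose i)))"
    using assms(1)[of "- 1 - real k"] by (simp only: val)
  also have "\<dots> = (\<Sum>i\<in>{k}. b i * ((- 1) ^ i * real (k choose i)))"
    proof (rule sum.mono_neutral_right)
    show "\<forall>i\<in>{..d} - {k}. b i * ((- 1) ^ i * real (k choose i)) = 0"
    proof
      fix i assume "i \<in> {..d} - {k}"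
      then show "b i * ((- 1) ^ i * real (k choose i)) = 0"
        using less.IH[of i] by (cases "i < k") (auto simp: binomial_eq_0)
    qed
  qed (use less.prems in auto)
  finally show ?case by simp
qed

text \<open>Both \<open>eventual_poly\<close> and \<open>binomial_coeffs\<close> are definite
  descriptions, so uniqueness has to be shown twice: polynomials that agree at all large naturals
  coincide, and the binomial basis is independent. The minus sign is (-1)^1, and d-1 is the binomial
  index that belongs to e_1.\<close>

lemma binomial_coeffs_eventual_poly:
  assumes "\<forall>\<^sub>F n in sequentially.
      ereal_of_enat (f n) = ereal (\<Sum>i<Suc d. c i * real ((n + i) choose i))"
    and "d \<ge> 1"
  shows "binomial_coeffs d (eventual_poly f) 1 = - c (d - 1)"
proof -
  obtain p :: "nat \<Rightarrow> real poly" where p: "\<And>i x. poly (p i) x = (x + real i) gchoose i"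
    using poly_gbinomial_shift by metis
  define Q where "Q = (\<Sum>i\<le>d. smult (c i) (p i))"
  have Q: "poly Q x = (\<Sum>i\<le>d. c i * ((x + real i) gchoose i))" for x
    by (simp add: Q_def poly_sum p)
  have evQ: "\<forall>\<^sub>F n in sequentially. ereal_of_enat (f n) = ereal (poly Q (real n))"
    using assms(1) by eventually_elim (simp add: Q binomial_gbinomial lessThan_Suc_atMost)
  have "eventual_poly f = Q"
    unfolding eventual_poly_def
  proof (rule the_equality)
    show "\<forall>\<^sub>F n in sequentially. ereal_of_enat (f n) = ereal (poly Q (real n))" by (rule evQ)
  next
    fix Q' assume "\<forall>\<^sub>F n in sequentially. ereal_of_enat (f n) = ereal (poly Q' (real n))"
    with evQ have "\<forall>\<^sub>F n in sequentially. poly (Q' - Q) (real n) = 0"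
      by eventually_elim auto
    then obtain N where N: "\<And>n. n \<ge> N \<Longrightarrow> poly (Q' - Q) (real n) = 0"
      unfolding eventually_sequentially by blast
    have "infinite (real ` {N..})"
      by (simp add: finite_image_iff infinite_Ici)
    moreover have "real ` {N..} \<subseteq> {x. poly (Q' - Q) x = 0}" using N by auto
    ultimately have "infinite {x. poly (Q' - Q) x = 0}" using infinite_super by blast
    then show "Q' = Q" using poly_roots_finite[of "Q' - Q"] by auto
  qed
  moreover define e where "e = (\<lambda>i. if i \<le> d then (- 1) ^ i * c (d - i) else 0)"
  have reindex: "(\<Sum>i\<le>d. (- 1) ^ i * g i * ((x + real (d - i)) gchoose (d - i)))
      = (\<Sum>i\<le>d. ((- 1) ^ (d - i) * g (d - i)) * ((x + real i) gchoose i))"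
    for g :: "nat \<Rightarrow> real" and x
    by (rule sum.reindex_bij_witness[of _ "\<lambda>i. d - i" "\<lambda>i. d - i"]) auto
  have sq: "(- 1) ^ k * ((- 1) ^ k * z) = z" for k and z :: real
    by (cases "even k") simp_all
  have "binomial_coeffs d Q = e"
    unfolding binomial_coeffs_def
  proof (rule the_equality)
    show "(\<forall>i>d. e i = 0) \<and>
        (\<forall>x. poly Q x = (\<Sum>i\<le>d. (- 1) ^ i * e i * ((x + real (d - i)) gchoose (d - i))))"
      unfolding reindex by (simp add: Q e_def sq)
  next
    fix e' assume e': "(\<forall>i>d. e' i = 0) \<and>
        (\<forall>x. poly Q x = (\<Sum>i\<le>d. (- 1) ^ i * e' i * ((x + real (d - i)) gchoose (d - i))))"
    have "c k - (- 1) ^ (d - k) * e' (d - k) = 0" if "k \<le> d" for k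
    proof (rule gbinomial_shift_independent[OF _ that])
      fix x :: real
      show "(\<Sum>i\<le>d. (c i - (- 1) ^ (d - i) * e' (d - i)) * ((x + real i) gchoose i)) = 0"
        using e' unfolding reindex Q by (simp add: left_diff_distrib sum_subtractf)
    qed
    from this[of "d - i" for i] have "e' i = e i" if "i \<le> d" for i
      using that sq[of i "e' i"] by (simp add: e_def)
    then show "e' = e" using e' by (auto simp: e_def)
  qed
  ultimately show ?thesis using assms(2) by (simp add: e_def)
qed

section \<open>Suprema of chain lengths\<close>

text \<open>The family of sets is arbitrary, so that chains of submodules and chains of ideals can
  be compared by strictly monotone maps.\<close>

definition strict_chain :: "'x set set \<Rightarrow> nat \<Rightarrow> (nat \<Rightarrow> 'x set) \<Rightarrow> bool" where
  "strict_chain \<F> n N \<longleftrightarrow> (\<forall>i\<le>n. N i \<in> \<F>) \<and> (\<forall>i<n. N i \<subset> N (Suc i))"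

definition chain_sup :: "'x set set \<Rightarrow> enat" where
  "chain_sup \<F> = Sup {enat n | n. \<exists>N. strict_chain \<F> n N}"

lemma chain_sup_upper: "strict_chain \<F> n N \<Longrightarrow> enat n \<le> chain_sup \<F>"
  unfolding chain_sup_def by (rule Sup_upper) blast

lemma chain_sup_least:
  "(\<And>n N. strict_chain \<F> n N \<Longrightarrow> enat n \<le> b) \<Longrightarrow> chain_sup \<F> \<le> b"
  unfolding chain_sup_def by (rule Sup_least) blast

text \<open>An infinite supremum is not attained, but any finite \<open>m\<close> below it is the
  length of some chain, because longer chains can be cut off.\<close>

lemma strict_chain_of_le_chain_sup:
  assumes "enat m \<le> chain_sup \<F>" "\<F> \<noteq> {}"
  obtains N where "strict_chain \<F> m N"
proof (cases m)
  case 0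
  from assms(2) obtain A where "A \<in> \<F>" by blast
  then have "strict_chain \<F> 0 (\<lambda>_. A)" by (simp add: strict_chain_def)
  then show ?thesis using that 0 by blast
next
  case (Suc k)
  show ?thesis
  proof (rule ccontr)
    assume no: "\<not> thesis"
    have "enat n \<le> enat k" if "strict_chain \<F> n N" for n N
    proof (rule ccontr)
      assume "\<not> enat n \<le> enat k"
      then have "strict_chain \<F> m N" using that Suc by (auto simp: strict_chain_def)
      then show False using no \<open>\<And>N. strict_chain \<F> m N \<Longrightarrow> thesis\<close> by blast
    qed
    then have "chain_sup \<F> \<le> enat k" by (rule chain_sup_least)
    then have "enat m \<le> enat k" using assms(1) by (rule order_trans[rotated])
    then show False using Suc by simp
  qed
qed

lemma chain_sup_transfer:
  assumes "\<And>A. A \<in> \<F> \<Longrightarrow> \<phi> A \<in> \<G>"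
    and "\<And>A B. A \<in> \<F> \<Longrightarrow> B \<in> \<F> \<Longrightarrow> A \<subset> B \<Longrightarrow> \<phi> A \<subset> \<phi> B"
  shows "chain_sup \<F> \<le> chain_sup \<G>"
proof (rule chain_sup_least)
  fix n N assume "strict_chain \<F> n N"
  then have "strict_chain \<G> n (\<lambda>i. \<phi> (N i))"
    using assms unfolding strict_chain_def by simp
  then show "enat n \<le> chain_sup \<G>" by (rule chain_sup_upper)
qed

text \<open>Repetitions are dropped, so the length is the number of places where the weak chain
  moves. The end point is recorded so that the induction can append the next member.\<close>

lemma strict_chain_of_weak_chain:
  assumes "\<And>i. i \<le> n \<Longrightarrow> M i \<in> \<F>" "\<And>i. i < n \<Longrightarrow> M i \<subseteq> M (Suc i)"
  shows "\<exists>N. strict_chain \<F> (card {i. i < n \<and> M i \<noteq> M (Suc i)}) N \<and>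
    N (card {i. i < n \<and> M i \<noteq> M (Suc i)}) = M n"
  using assms
proof (induction n)
  case 0
  then show ?case by (intro exI[of _ M]) (simp add: strict_chain_def)
next
  case (Suc n)
  let ?c = "\<lambda>n. card {i. i < n \<and> M i \<noteq> M (Suc i)}"
  obtain N where N: "strict_chain \<F> (?c n) N" "N (?c n) = M n"
    using Suc by force
  show ?case
  proof (cases "M n = M (Suc n)")
    case True
    then have "{i. i < Suc n \<and> M i \<noteq> M (Suc i)} = {i. i < n \<and> M i \<noteq> M (Suc i)}"
      by (auto simp: less_Suc_eq)
    then show ?thesis using N True by auto
  next
    case False
    then have "{i. i < Suc n \<and> M i \<noteq> M (Suc i)} = insert n {i. i < n \<and> M i \<noteq> M (Suc i)}"
      by (auto simp: less_Suc_eq)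
    then have c: "?c (Suc n) = Suc (?c n)" by simp
    have "strict_chain \<F> (Suc (?c n)) (N(Suc (?c n) := M (Suc n)))"
      using N Suc.prems(1)[of "Suc n"] Suc.prems(2)[of n] False
      by (auto simp: strict_chain_def less_Suc_eq le_Suc_eq)
    moreover have "(N(Suc (?c n) := M (Suc n))) (Suc (?c n)) = M (Suc n)" by simp
    ultimately show ?thesis
      unfolding c by (intro exI[of _ "N(Suc (?c n) := M (Suc n))"] conjI)
  qed
qed

text \<open>Each step of a strict chain is strict under \<open>\<phi>\<close> or under
  \<open>\<psi>\<close>, so its length is at most the number of moves of the two image chains
  together.\<close>

lemma chain_sup_le_add:
  assumes mem: "\<And>A. A \<in> \<F> \<Longrightarrow> \<phi> A \<in> \<G>" "\<And>A. A \<in> \<F> \<Longrightarrow> \<psi> A \<in> \<H>"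
    and mono: "\<And>A B. A \<in> \<F> \<Longrightarrow> B \<in> \<F> \<Longrightarrow> A \<subset> B \<Longrightarrow>
      \<phi> A \<subseteq> \<phi> B \<and> \<psi> A \<subseteq> \<psi> B \<and> (\<phi> A \<noteq> \<phi> B \<or> \<psi> A \<noteq> \<psi> B)"
  shows "chain_sup \<F> \<le> chain_sup \<G> + chain_sup \<H>"
proof (rule chain_sup_least)
  fix n N assume N: "strict_chain \<F> n N"
  define P where "P = {i. i < n \<and> \<phi> (N i) \<noteq> \<phi> (N (Suc i))}"
  define Q where "Q = {i. i < n \<and> \<psi> (N i) \<noteq> \<psi> (N (Suc i))}"
  have step: "\<phi> (N i) \<subseteq> \<phi> (N (Suc i)) \<and> \<psi> (N i) \<subseteq> \<psi> (N (Suc i))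
      \<and> (\<phi> (N i) \<noteq> \<phi> (N (Suc i)) \<or> \<psi> (N i) \<noteq> \<psi> (N (Suc i)))" if "i < n" for i
    using N that by (intro mono) (auto simp: strict_chain_def)
  have in_F: "N i \<in> \<F>" if "i \<le> n" for i using N that by (simp add: strict_chain_def)
  have "enat (card P) \<le> chain_sup \<G>"
    using strict_chain_of_weak_chain[of n "\<lambda>i. \<phi> (N i)" \<G>] step mem in_F
    unfolding P_def by (blast intro: chain_sup_upper)
  moreover have "enat (card Q) \<le> chain_sup \<H>"
    using strict_chain_of_weak_chain[of n "\<lambda>i. \<psi> (N i)" \<H>] step mem in_F
    unfolding Q_def by (blast intro: chain_sup_upper)
  moreover have "n \<le> card P + card Q"
  proof -
    have "{..<n} \<subseteq> P \<union> Q" using step by (auto simp: P_def Q_def)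
    then have "card {..<n} \<le> card (P \<union> Q)" by (intro card_mono) (auto simp: P_def Q_def)
    also have "\<dots> \<le> card P + card Q" by (rule card_Un_le)
    finally show ?thesis by simp
  qed
  ultimately have "enat n \<le> enat (card P) + enat (card Q)"
    "enat (card P) + enat (card Q) \<le> chain_sup \<G> + chain_sup \<H>"
    by (simp, intro add_mono)
  then show "enat n \<le> chain_sup \<G> + chain_sup \<H>" by (rule order_trans)
qed

lemma enat_add_leI:
  assumes "\<And>m n. enat m \<le> a \<Longrightarrow> enat n \<le> b \<Longrightarrow> enat (m + n) \<le> c"
  shows "a + b \<le> c"
proof (cases "a = \<infinity> \<or> b = \<infinity>")
  case True
  then have "enat n \<le> c" for n
    using assms[of n 0] assms[of 0 n] by (auto simp: zero_enat_def[symmetric])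
  then have "c = \<infinity>"
    by (metis Suc_ile_eq enat_ord_simps(2) less_irrefl not_enat_eq)
  then show ?thesis by simp
next
  case False
  then obtain m n where "a = enat m" "b = enat n" by auto
  then show ?thesis using assms[of m n] by simp
qed

lemma chain_sup_add_le:
  assumes "\<And>A. A \<in> \<G> \<Longrightarrow> A \<in> \<F> \<and> A \<subseteq> L" "\<And>A. A \<in> \<H> \<Longrightarrow> A \<in> \<F> \<and> L \<subseteq> A"
    and "\<G> \<noteq> {}" "\<H> \<noteq> {}"
  shows "chain_sup \<G> + chain_sup \<H> \<le> chain_sup \<F>"
proof (rule enat_add_leI)
  fix m n assume "enat m \<le> chain_sup \<G>" "enat n \<le> chain_sup \<H>"
  then obtain N N' where N: "strict_chain \<G> m N" "strict_chain \<H> n N'"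
    using assms by (metis strict_chain_of_le_chain_sup)
  \<comment> \<open>The last member \<open>N m\<close> is left out: it lies in \<open>L\<close>,
    which lies in \<open>N' 0\<close>, and both may equal \<open>L\<close>. Dropping it keeps the
    chain strict with exactly m+n steps.\<close>
  define P where "P = (\<lambda>i. if i < m then N i else N' (i - m))"
  have "P i \<in> \<F>" if "i \<le> m + n" for i
    using N assms that by (auto simp: strict_chain_def P_def)
  moreover have "P i \<subset> P (Suc i)" if "i < m + n" for i
  proof -
    consider "Suc i < m" | "Suc i = m" | "m \<le> i" by linarith
    then show ?thesis
    proof cases
      case 1
      then show ?thesis using N by (simp add: P_def strict_chain_def)
    next
      case 2
      then have "N i \<subset> N m" "N m \<subseteq> L" "L \<subseteq> N' 0"
        using N assms by (auto simp: strict_chain_def)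
      then show ?thesis using 2 by (auto simp: P_def)
    next
      case 3
      then show ?thesis using N that by (simp add: P_def strict_chain_def Suc_diff_le)
    qed
  qed
  ultimately have "strict_chain \<F> (m + n) P" by (simp add: strict_chain_def)
  then show "enat (m + n) \<le> chain_sup \<F>" by (rule chain_sup_upper)
qed


section \<open>Lengths of quotients of ideals\<close>

context cring
begin

lemma cidealI:
  assumes "I \<subseteq> carrier R" "\<zero> \<in> I" "\<And>x y. x \<in> I \<Longrightarrow> y \<in> I \<Longrightarrow> x \<oplus> y \<in> I"
    and "\<And>r x. r \<in> carrier R \<Longrightarrow> x \<in> I \<Longrightarrow> r \<otimes> x \<in> I"
  shows "ideal I R"
proof (rule idealI[OF ring_axioms])
  have inv: "\<ominus> x \<in> I" if "x \<in> I" for x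
    using assms(4)[of "\<ominus> \<one>" x] that assms(1) by (auto simp: l_minus)
  show "subgroup I (add_monoid R)"
    using assms inv by (auto simp: subgroup_def a_inv_def)
  show "\<And>a x. a \<in> I \<Longrightarrow> x \<in> carrier R \<Longrightarrow> x \<otimes> a \<in> I" using assms(4) by blast
  show "\<And>a x. a \<in> I \<Longrightarrow> x \<in> carrier R \<Longrightarrow> a \<otimes> x \<in> I"
    using assms(1,4) m_comm by (metis subsetD)
qed

lemma ideal_subset: "ideal I R \<Longrightarrow> I \<subseteq> carrier R"
  by (auto intro: ideal.Icarr)

lemma ideal_zero: "ideal I R \<Longrightarrow> \<zero> \<in> I"
  by (simp add: additive_subgroup.zero_closed ideal.axioms(1))

lemma ideal_add: "ideal I R \<Longrightarrow> x \<in> I \<Longrightarrow> y \<in> I \<Longrightarrow> x \<oplus> y \<in> I"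
  by (simp add: additive_subgroup.a_closed ideal.axioms(1))

lemma ideal_minus: "ideal I R \<Longrightarrow> x \<in> I \<Longrightarrow> \<ominus> x \<in> I"
  by (simp add: additive_subgroup.a_inv_closed ideal.axioms(1))

lemma ideal_diff: "ideal I R \<Longrightarrow> x \<in> I \<Longrightarrow> y \<in> I \<Longrightarrow> x \<ominus> y \<in> I"
  by (simp add: a_minus_def ideal_add ideal_minus)

lemma ideal_add_cancel:
  assumes "ideal I R" "x \<in> I" "x \<oplus> y \<in> I" "y \<in> carrier R"
  shows "y \<in> I"
proof -
  have "y = (x \<oplus> y) \<ominus> x"
    using assms ideal.Icarr[OF assms(1,2)] by (simp add: a_minus_def a_comm r_neg1 a_assoc r_neg2)
  then show ?thesis using ideal_diff[OF assms(1,3,2)] by simp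
qed

lemma ideal_sum_ideals:
  assumes "ideal I R" "ideal K R"
  shows "ideal (set_add R I K) R" "I \<subseteq> set_add R I K" "K \<subseteq> set_add R I K"
proof -
  show "ideal (set_add R I K) R" by (rule add_ideals[OF assms])
  show "I \<subseteq> set_add R I K"
    using ideal_zero[OF assms(2)] ideal_subset[OF assms(1)] by (force simp: set_add_def')
  show "K \<subseteq> set_add R I K"
    using ideal_zero[OF assms(1)] ideal_subset[OF assms(2)] by (force simp: set_add_def')
qed

lemma ideal_sum_least:
  assumes "ideal L R" "I \<subseteq> L" "K \<subseteq> L"
  shows "set_add R I K \<subseteq> L"
  using assms ideal_add[OF assms(1)] by (auto simp: set_add_def')

definition between :: "'a set \<Rightarrow> 'a set \<Rightarrow> 'a set set" where
  "between K I = {N. ideal N R \<and> K \<subseteq> N \<and> N \<subseteq> I}"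

text \<open>The submodules of I/K correspond to the ideals between \<open>K\<close> and
  \<open>I\<close>, so this is the length of the quotient; the smaller ideal is the first
  argument.\<close>

definition len :: "'a set \<Rightarrow> 'a set \<Rightarrow> enat" where
  "len K I = chain_sup (between K I)"

lemma len_mono:
  assumes "K \<subseteq> K'" "I' \<subseteq> I"
  shows "len K' I' \<le> len K I"
  unfolding len_def by (rule chain_sup_transfer[where \<phi> = id]) (use assms in \<open>auto simp: between_def\<close>)

lemma len_refl: "len K K = 0"
proof -
  have "enat n \<le> 0" if "strict_chain (between K K) n N" for n N
  proof (cases n)
    case (Suc m)
    then have "N 0 \<subset> N 1" "N 0 = K" "N 1 = K"
      using that by (auto simp: strict_chain_def between_def)
    then show ?thesis by simp
  qed (simp add: zero_enat_def)
  then have "len K K \<le> 0" unfolding len_def by (rule chain_sup_least)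
  then show ?thesis by simp
qed

text \<open>Chains below and above \<open>L\<close> can be joined, which gives one inequality. For
  the other, an ideal \<open>N\<close> is sent to its intersection and its sum with
  \<open>L\<close>; by the modular law a proper inclusion cannot keep both.\<close>

lemma len_add:
  assumes "ideal K R" "ideal L R" "ideal I R" "K \<subseteq> L" "L \<subseteq> I"
  shows "len K I = len K L + len L I"
proof (rule antisym)
  show "len K L + len L I \<le> len K I"
    unfolding len_def
  proof (rule chain_sup_add_le)
    show "A \<in> between K I \<and> A \<subseteq> L" if "A \<in> between K L" for A
      using that assms(5) by (auto simp: between_def)
    show "A \<in> between K I \<and> L \<subseteq> A" if "A \<in> between L I" for A
      using that assms(4) by (auto simp: between_def)
    have "K \<in> between K L" "I \<in> between L I" using assms by (auto simp: between_def)
    then show "between K L \<noteq> {}" "between L I \<noteq> {}" by blast+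
  qed
  show "len K I \<le> len K L + len L I"
    unfolding len_def
  proof (rule chain_sup_le_add[where \<phi> = "\<lambda>N. N \<inter> L" and \<psi> = "\<lambda>N. set_add R N L"])
    fix N assume N: "N \<in> between K I"
    then show "N \<inter> L \<in> between K L"
      using assms i_intersect by (auto simp: between_def)
    from N show "set_add R N L \<in> between L I"
      using assms ideal_sum_ideals[of N L] ideal_sum_least[of I N L] by (auto simp: between_def)
  next
    fix N N' assume "N \<in> between K I" "N' \<in> between K I" and less: "N \<subset> N'"
    then have id: "ideal N R" "ideal N' R" by (auto simp: between_def)
    have "N \<inter> L \<noteq> N' \<inter> L" if eq: "set_add R N L = set_add R N' L"
    proof
      assume eq': "N \<inter> L = N' \<inter> L"
      have "x \<in> N" if x: "x \<in> N'" for x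
      proof -
        have "x \<in> set_add R N L" using x ideal_sum_ideals(2)[OF id(2) assms(2)] eq by blast
        then obtain n l where nl: "n \<in> N" "l \<in> L" "x = n \<oplus> l" by (auto simp: set_add_def')
        then have "l \<in> N'"
          using ideal_add_cancel[OF id(2), of n l] less x ideal.Icarr[OF assms(2)] by blast
        then have "l \<in> N" using nl eq' by blast
        then show ?thesis using nl ideal_add[OF id(1)] by blast
      qed
      then show False using less by blast
    qed
    moreover have "set_add R N L \<subseteq> set_add R N' L" using less by (auto simp: set_add_def')
    ultimately show "N \<inter> L \<subseteq> N' \<inter> L \<and> set_add R N L \<subseteq> set_add R N' L \<and>
        (N \<inter> L \<noteq> N' \<inter> L \<or> set_add R N L \<noteq> set_add R N' L)"
      using less by blast
  qed
qed

section \<open>Colon ideals and the ideals V + aM\<close>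

definition colon :: "'a set \<Rightarrow> 'a \<Rightarrow> 'a set \<Rightarrow> 'a set" where
  "colon M a V = {g \<in> M. a \<otimes> g \<in> V}"

definition adjoin :: "'a set \<Rightarrow> 'a \<Rightarrow> 'a set \<Rightarrow> 'a set" where
  "adjoin V a M = {t \<oplus> a \<otimes> g | t g. t \<in> V \<and> g \<in> M}"

lemma colon_ideal:
  assumes "ideal M R" "ideal V R" "a \<in> carrier R"
  shows "ideal (colon M a V) R"
proof (rule cidealI)
  fix r x assume "r \<in> carrier R" "x \<in> colon M a V"
  moreover from this have "a \<otimes> (r \<otimes> x) = r \<otimes> (a \<otimes> x)"
    using assms ideal.Icarr[OF assms(1)] by (simp add: colon_def m_lcomm)
  ultimately show "r \<otimes> x \<in> colon M a V"
    using assms by (simp add: colon_def ideal.I_l_closed)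
qed (use assms ideal.Icarr[OF assms(1)] in
    \<open>auto simp: colon_def r_distr ideal_add ideal_zero\<close>)

lemma adjoin_ideal:
  assumes "ideal V R" "ideal M R" "a \<in> carrier R"
  shows "ideal (adjoin V a M) R"
proof (rule cidealI)
  note carr = ideal.Icarr[OF assms(1)] ideal.Icarr[OF assms(2)]
  show "adjoin V a M \<subseteq> carrier R"
    using carr assms by (auto simp: adjoin_def)
  show "\<zero> \<in> adjoin V a M"
    using ideal_zero[OF assms(1)] ideal_zero[OF assms(2)] assms(3)
    unfolding adjoin_def by (intro CollectI exI[of _ \<zero>]) simp
  fix x assume "x \<in> adjoin V a M"
  then obtain t g where x: "x = t \<oplus> a \<otimes> g" "t \<in> V" "g \<in> M" by (auto simp: adjoin_def)
  {
    fix y assume "y \<in> adjoin V a M"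
    then obtain u h where y: "y = u \<oplus> a \<otimes> h" "u \<in> V" "h \<in> M" by (auto simp: adjoin_def)
    have "x \<oplus> y = (t \<oplus> u) \<oplus> a \<otimes> (g \<oplus> h)"
      using x y carr assms(3) by (simp add: r_distr a_ac)
    then show "x \<oplus> y \<in> adjoin V a M"
      using x y ideal_add[OF assms(1)] ideal_add[OF assms(2)] unfolding adjoin_def by blast
  next
    fix r assume r: "r \<in> carrier R"
    have "r \<otimes> x = (r \<otimes> t) \<oplus> a \<otimes> (r \<otimes> g)"
      using x r carr assms(3) by (simp add: r_distr m_lcomm)
    then show "r \<otimes> x \<in> adjoin V a M"
      using x r ideal.I_l_closed[OF assms(1)] ideal.I_l_closed[OF assms(2)]
      unfolding adjoin_def by blast
  }
qed

lemma subset_adjoin: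
  assumes "ideal V R" "ideal M R" "a \<in> carrier R"
  shows "V \<subseteq> adjoin V a M"
proof
  fix t assume "t \<in> V"
  then have "t = t \<oplus> a \<otimes> \<zero>" using assms ideal.Icarr[OF assms(1)] by simp
  then show "t \<in> adjoin V a M"
    using \<open>t \<in> V\<close> ideal_zero[OF assms(2)] unfolding adjoin_def by blast
qed

lemma mult_mem_adjoin:
  assumes "ideal V R" "ideal M R" "a \<in> carrier R" "g \<in> M"
  shows "a \<otimes> g \<in> adjoin V a M"
proof -
  have "a \<otimes> g = \<zero> \<oplus> a \<otimes> g" using assms ideal.Icarr[OF assms(2)] by simp
  then show ?thesis
    using assms ideal_zero[OF assms(1)] unfolding adjoin_def by blast
qed

text \<open>Multiplication by \<open>a\<close> induces an isomorphism from \<open>M\<close> modulo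
  \<open>colon M a V\<close> onto (V + aM)/V. On ideals its two directions are
  \<open>colon M a\<close> and \<open>adjoin V a\<close>, and strict monotonicity of each gives one
  inequality.\<close>

lemma len_adjoin:
  assumes "ideal V R" "ideal M R" "a \<in> carrier R"
  shows "len V (adjoin V a M) = len (colon M a V) M"
proof (rule antisym)
  note carr = ideal.Icarr[OF assms(1)] ideal.Icarr[OF assms(2)]
  show "len V (adjoin V a M) \<le> len (colon M a V) M"
    unfolding len_def
  proof (rule chain_sup_transfer[where \<phi> = "colon M a"])
    fix N assume "N \<in> between V (adjoin V a M)"
    then show "colon M a N \<in> between (colon M a V) M"
      using colon_ideal[OF assms(2) _ assms(3)] by (auto simp: between_def colon_def)
  next
    fix N N' assume N: "N \<in> between V (adjoin V a M)" "N' \<in> between V (adjoin V a M)" "N \<subset> N'"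
    then have id: "ideal N R" "ideal N' R" by (auto simp: between_def)
    obtain x where x: "x \<in> N'" "x \<notin> N" using N by blast
    then have "x \<in> adjoin V a M" using N(2) by (auto simp: between_def)
    then obtain t g where tg: "x = t \<oplus> a \<otimes> g" "t \<in> V" "g \<in> M"
      by (auto simp: adjoin_def)
    have "t \<in> N" "t \<in> N'" using tg N by (auto simp: between_def)
    then have "g \<in> colon M a N'" "g \<notin> colon M a N"
      using x tg ideal_add_cancel[OF id(2), of t "a \<otimes> g"] ideal_add[OF id(1), of t "a \<otimes> g"]
        carr(2) assms(3) by (auto simp: colon_def)
    then show "colon M a N \<subset> colon M a N'" using N(3) by (auto simp: colon_def)
  qed
  show "len (colon M a V) M \<le> len V (adjoin V a M)"
    unfolding len_def
  proof (rule chain_sup_transfer[where \<phi> = "adjoin V a"])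
    fix N assume "N \<in> between (colon M a V) M"
    then have "ideal N R" "N \<subseteq> M" by (auto simp: between_def)
    moreover from this have "adjoin V a N \<subseteq> adjoin V a M" by (auto simp: adjoin_def)
    ultimately show "adjoin V a N \<in> between V (adjoin V a M)"
      using adjoin_ideal[OF assms(1) _ assms(3)] subset_adjoin[OF assms(1) _ assms(3)]
      by (auto simp: between_def)
  next
    fix N N' assume N: "N \<in> between (colon M a V) M" "N' \<in> between (colon M a V) M" "N \<subset> N'"
    then have id: "ideal N R" "ideal N' R" by (auto simp: between_def)
    obtain g where g: "g \<in> N'" "g \<notin> N" using N by blast
    have "a \<otimes> g \<notin> adjoin V a N"
    proof
      assume "a \<otimes> g \<in> adjoin V a N"
      then obtain t h where th: "a \<otimes> g = t \<oplus> a \<otimes> h" "t \<in> V" "h \<in> N" by (auto simp: adjoin_def)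
      have gM: "g \<in> M" "h \<in> M" using g th N by (auto simp: between_def)
      have "a \<otimes> (g \<ominus> h) = t"
        using th gM carr assms(3)
        by (simp add: a_minus_def r_distr r_minus a_assoc r_neg)
      then have "g \<ominus> h \<in> colon M a V"
        using th gM ideal_diff[OF assms(2)] by (simp add: colon_def)
      then have "g \<ominus> h \<in> N" using N by (auto simp: between_def)
      then have "h \<oplus> (g \<ominus> h) \<in> N" using th ideal_add[OF id(1)] by blast
      moreover have "h \<oplus> (g \<ominus> h) = g"
        using gM carr by (simp add: a_minus_def a_lcomm r_neg)
      ultimately show False using g by simp
    qed
    moreover have "a \<otimes> g \<in> adjoin V a N'"
      by (rule mult_mem_adjoin[OF assms(1) id(2) assms(3) g(1)])
    moreover have "adjoin V a N \<subseteq> adjoin V a N'"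
      using N(3) by (auto simp: adjoin_def)
    ultimately show "adjoin V a N \<subset> adjoin V a N'" by blast
  qed
qed


section \<open>Agreement with the length of the quotient module\<close>

lemma quot_length_eq_len:
  assumes K: "ideal K R" and I: "ideal I R" and KI: "K \<subseteq> I"
  shows "quot_length R I K = len K I"
proof -
  define Q where "Q = quot_module ((regular_module R)\<lparr>carrier := I\<rparr>) K"
  define cos where "cos = (\<lambda>x. {k \<oplus> x | k. k \<in> K})"
  note carrK = ideal.Icarr[OF K] and carrI = ideal.Icarr[OF I]
  have carrier_Q: "carrier Q = cos ` I"
    by (auto simp: Q_def quot_module_def regular_module_def A_RCOSETS_def' a_r_coset_def' cos_def)
  have add_Q: "X \<oplus>\<^bsub>Q\<^esub> Y = {x \<oplus> y | x y. x \<in> X \<and> y \<in> Y}" for X Y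
    by (auto simp: Q_def quot_module_def regular_module_def set_add_def')
  have smult_Q: "r \<odot>\<^bsub>Q\<^esub> X = (\<Union>x\<in>X. cos (r \<otimes> x))" for r X
    by (auto simp: Q_def quot_module_def regular_module_def a_r_coset_def' cos_def)
  have zero_Q: "\<zero>\<^bsub>Q\<^esub> = K"
    by (simp add: Q_def quot_module_def)
  have cosI: "z \<in> cos x" if "k \<in> K" "z = k \<oplus> x" for z k x
    using that by (auto simp: cos_def)
  have cos_self: "x \<in> cos x" if "x \<in> I" for x
    using that carrI ideal_zero[OF K] by (force simp: cos_def)
  have cos_eq: "cos x = cos y" if xy: "x \<in> cos y" "y \<in> I" for x y
  proof -
    obtain k where k: "k \<in> K" "x = k \<oplus> y" using xy by (auto simp: cos_def)
    have shift: "l \<oplus> x = (l \<oplus> k) \<oplus> y" "l \<oplus> y = (l \<ominus> k) \<oplus> x" if "l \<in> K" for l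
      using that k carrK carrI[OF \<open>y \<in> I\<close>] by (auto simp: a_minus_def a_assoc r_neg1 r_neg2)
    show ?thesis
    proof (intro subset_antisym subsetI)
      fix z assume "z \<in> cos x"
      then obtain l where "l \<in> K" "z = l \<oplus> x" by (auto simp: cos_def)
      then show "z \<in> cos y" using cosI[OF ideal_add[OF K] shift(1)] k(1) by blast
    next
      fix z assume "z \<in> cos y"
      then obtain l where "l \<in> K" "z = l \<oplus> y" by (auto simp: cos_def)
      then show "z \<in> cos x" using cosI[OF ideal_diff[OF K] shift(2)] k(1) by blast
    qed
  qed
  have cos_subset: "cos x \<subseteq> N" if "ideal N R" "K \<subseteq> N" "x \<in> N" for x N
    using that ideal_add[OF that(1)] by (auto simp: cos_def)
  have cos_add: "cos x \<oplus>\<^bsub>Q\<^esub> cos y = cos (x \<oplus> y)" if "x \<in> I" "y \<in> I" for x y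
  proof -
    have split: "(k \<oplus> x) \<oplus> (l \<oplus> y) = (k \<oplus> l) \<oplus> (x \<oplus> y)" if "k \<in> K" "l \<in> K" for k l
      using that \<open>x \<in> I\<close> \<open>y \<in> I\<close> carrK carrI by (simp add: a_ac)
    have merge: "k \<oplus> (x \<oplus> y) = (k \<oplus> x) \<oplus> (\<zero> \<oplus> y)" if "k \<in> K" for k
      using that \<open>x \<in> I\<close> \<open>y \<in> I\<close> carrK carrI by (simp add: a_assoc)
    show ?thesis
    proof (intro subset_antisym subsetI)
      fix z assume "z \<in> cos x \<oplus>\<^bsub>Q\<^esub> cos y"
      then obtain k l where "k \<in> K" "l \<in> K" "z = (k \<oplus> x) \<oplus> (l \<oplus> y)"
        by (auto simp: add_Q cos_def)
      then show "z \<in> cos (x \<oplus> y)" using cosI[OF ideal_add[OF K] split] by blast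
    next
      fix z assume "z \<in> cos (x \<oplus> y)"
      then obtain k where k: "k \<in> K" "z = k \<oplus> (x \<oplus> y)" by (auto simp: cos_def)
      then show "z \<in> cos x \<oplus>\<^bsub>Q\<^esub> cos y"
        unfolding add_Q using merge[OF k(1)] cosI[OF k(1) refl] cosI[OF ideal_zero[OF K] refl]
        by (intro CollectI exI[of _ "k \<oplus> x"] exI[of _ "\<zero> \<oplus> y"]) simp
    qed
  qed
  have cos_smult: "r \<odot>\<^bsub>Q\<^esub> cos x = cos (r \<otimes> x)" if "r \<in> carrier R" "x \<in> I" for r x
  proof -
    have "cos (r \<otimes> y) = cos (r \<otimes> x)" if y: "y \<in> cos x" for y
    proof (rule cos_eq)
      obtain k where "k \<in> K" "y = k \<oplus> x" using y by (auto simp: cos_def)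
      then have "r \<otimes> y = r \<otimes> k \<oplus> r \<otimes> x" "r \<otimes> k \<in> K"
        using \<open>r \<in> carrier R\<close> \<open>x \<in> I\<close> carrK carrI ideal.I_l_closed[OF K] by (auto simp: r_distr)
      then show "r \<otimes> y \<in> cos (r \<otimes> x)" by (auto simp: cos_def)
      show "r \<otimes> x \<in> I" using \<open>r \<in> carrier R\<close> \<open>x \<in> I\<close> ideal.I_l_closed[OF I] by blast
    qed
    then show ?thesis unfolding smult_Q using cos_self[OF \<open>x \<in> I\<close>] by blast
  qed
  have cos_zero: "cos \<zero> = K" unfolding cos_def using carrK by force
  have cos_K: "cos x = K" if "x \<in> K" for x
    using cos_eq[of x \<zero>] cos_zero that ideal_zero[OF I] by simp
  \<comment> \<open>A submodule is closed under \<open>inv\<close>, which is a definite description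
    over the carrier of \<open>Q\<close>. Its value is computed directly, since \<open>Q\<close> has
    not been shown to be a group.\<close>
  have inv_Q: "inv\<^bsub>add_monoid Q\<^esub> cos x = cos (\<ominus> x)" if x: "x \<in> I" for x
  proof -
    have mx: "\<ominus> x \<in> I" using x ideal_minus[OF I] by blast
    have eqs: "cos x \<oplus>\<^bsub>Q\<^esub> cos (\<ominus> x) = K" "cos (\<ominus> x) \<oplus>\<^bsub>Q\<^esub> cos x = K"
      using x mx carrI by (simp_all add: cos_add r_neg l_neg cos_zero)
    have uniq: "Y = cos (\<ominus> x)" if Y: "Y \<in> cos ` I" "cos x \<oplus>\<^bsub>Q\<^esub> Y = K" for Y
    proof -
      obtain y where y: "y \<in> I" "Y = cos y" using Y by blast
      then have "x \<oplus> y \<in> K"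
        using Y x cos_self[of "x \<oplus> y"] ideal_add[OF I, of x y] by (simp add: cos_add)
      moreover have "y = (x \<oplus> y) \<oplus> \<ominus> x"
        using x y carrI by (simp add: a_comm a_assoc r_neg1)
      ultimately have "y \<in> cos (\<ominus> x)" by (auto simp: cos_def)
      then show ?thesis using cos_eq[of y "\<ominus> x"] mx y by simp
    qed
    show ?thesis
      unfolding m_inv_def
      by (rule the_equality) (use eqs uniq mx in \<open>auto simp: carrier_Q zero_Q\<close>)
  qed
  \<comment> \<open>The union of cosets in one direction and the image under \<open>cos\<close> in
    the other are both strictly monotone, which already makes the two suprema equal.\<close>
  have "chain_sup {N. submodule N R Q} = chain_sup (between K I)"
  proof (rule antisym)
    show "chain_sup {N. submodule N R Q} \<le> chain_sup (between K I)"
    proof (rule chain_sup_transfer[where \<phi> = Union])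
      fix H assume "H \<in> {N. submodule N R Q}"
      then have sub: "subgroup H (add_monoid Q)"
        and sm: "\<And>a x. a \<in> carrier R \<Longrightarrow> x \<in> H \<Longrightarrow> a \<odot>\<^bsub>Q\<^esub> x \<in> H"
        by (auto simp: submodule_def submodule_axioms_def)
      have H_sub: "H \<subseteq> cos ` I" using subgroup.subset[OF sub] by (simp add: carrier_Q)
      have H_add: "X \<oplus>\<^bsub>Q\<^esub> Y \<in> H" if "X \<in> H" "Y \<in> H" for X Y
        using subgroup.m_closed[OF sub that] by simp
      have KH: "K \<in> H" using subgroup.one_closed[OF sub] by (simp add: zero_Q)
      have HI: "\<Union>H \<subseteq> I" using H_sub cos_subset[OF I KI] by blast
      have cosH: "cos x \<in> H" if x: "x \<in> \<Union>H" for x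
      proof -
        obtain y where "y \<in> I" "cos y \<in> H" "x \<in> cos y" using x H_sub by blast
        then show ?thesis using cos_eq by metis
      qed
      have "ideal (\<Union>H) R"
      proof (rule cidealI)
        show "\<Union>H \<subseteq> carrier R" using HI ideal_subset[OF I] by blast
        show "\<zero> \<in> \<Union>H" using KH ideal_zero[OF K] by blast
        fix x assume x: "x \<in> \<Union>H"
        {
          fix y assume y: "y \<in> \<Union>H"
          have "cos (x \<oplus> y) \<in> H"
            using H_add[OF cosH[OF x] cosH[OF y]] cos_add x y HI by (metis subsetD)
          then show "x \<oplus> y \<in> \<Union>H"
            using cos_self ideal_add[OF I] x y HI by (meson UnionI subsetD)
        next
          fix r assume r: "r \<in> carrier R"
          have "cos (r \<otimes> x) \<in> H"
            using sm[OF r cosH[OF x]] cos_smult[OF r] x HI by (metis subsetD)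
          then show "r \<otimes> x \<in> \<Union>H"
            using cos_self ideal.I_l_closed[OF I] r x HI by (meson UnionI subsetD)
        }
      qed
      then show "\<Union>H \<in> between K I" using KH HI by (auto simp: between_def)
    next
      fix H H' assume H: "H \<in> {N. submodule N R Q}" "H' \<in> {N. submodule N R Q}" "H \<subset> H'"
      then have sub: "H \<subseteq> cos ` I" "H' \<subseteq> cos ` I"
        using subgroup.subset[of H "add_monoid Q"] subgroup.subset[of H' "add_monoid Q"]
        by (auto simp: submodule_def carrier_Q)
      obtain x where x: "x \<in> I" "cos x \<in> H'" "cos x \<notin> H" using H(3) sub by blast
      have "x \<notin> \<Union>H"
      proof
        assume "x \<in> \<Union>H"
        then obtain y where "y \<in> I" "cos y \<in> H" "x \<in> cos y" using sub by blast
        then show False using cos_eq x by metis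
      qed
      then show "\<Union>H \<subset> \<Union>H'" using cos_self[OF x(1)] x(2) H(3) by blast
    qed
    show "chain_sup (between K I) \<le> chain_sup {N. submodule N R Q}"
    proof (rule chain_sup_transfer[where \<phi> = "(`) cos"])
      fix N assume "N \<in> between K I"
      then have N: "ideal N R" "K \<subseteq> N" "N \<subseteq> I" by (auto simp: between_def)
      have "subgroup (cos ` N) (add_monoid Q)"
      proof (rule subgroup.intro)
        show "cos ` N \<subseteq> carrier (add_monoid Q)" using N by (auto simp: carrier_Q)
        show "\<one>\<^bsub>add_monoid Q\<^esub> \<in> cos ` N"
          using cos_zero ideal_zero[OF N(1)] by (force simp: zero_Q)
        show "X \<otimes>\<^bsub>add_monoid Q\<^esub> Y \<in> cos ` N" if XY: "X \<in> cos ` N" "Y \<in> cos ` N" for X Y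
        proof -
          obtain x y where xy: "x \<in> N" "y \<in> N" "X = cos x" "Y = cos y" using XY by blast
          then have "X \<otimes>\<^bsub>add_monoid Q\<^esub> Y = cos (x \<oplus> y)" using cos_add[of x y] N(3) by auto
          then show ?thesis using ideal_add[OF N(1) xy(1,2)] by blast
        qed
        show "inv\<^bsub>add_monoid Q\<^esub> X \<in> cos ` N" if X: "X \<in> cos ` N" for X
        proof -
          obtain x where x: "x \<in> N" "X = cos x" using X by blast
          then have "inv\<^bsub>add_monoid Q\<^esub> X = cos (\<ominus> x)" using inv_Q[of x] N(3) by blast
          then show ?thesis using ideal_minus[OF N(1) x(1)] by blast
        qed
      qed
      moreover have "r \<odot>\<^bsub>Q\<^esub> X \<in> cos ` N" if rX: "r \<in> carrier R" "X \<in> cos ` N" for r X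
      proof -
        obtain x where x: "x \<in> N" "X = cos x" using rX(2) by blast
        then have "r \<odot>\<^bsub>Q\<^esub> X = cos (r \<otimes> x)" using cos_smult[OF rX(1), of x] N(3) by blast
        then show ?thesis using ideal.I_l_closed[OF N(1) x(1) rX(1)] by blast
      qed
      ultimately show "cos ` N \<in> {N. submodule N R Q}"
        by (simp add: submodule_def submodule_axioms_def)
    next
      fix N N' assume N: "N \<in> between K I" "N' \<in> between K I" "N \<subset> N'"
      then obtain x where x: "x \<in> N'" "x \<notin> N" by blast
      have "cos x \<notin> cos ` N"
      proof
        assume "cos x \<in> cos ` N"
        then obtain y where "y \<in> N" "cos x = cos y" by blast
        then have "cos x \<subseteq> N" using N cos_subset[of N y] by (auto simp: between_def)
        moreover have "x \<in> I" using x(1) N(2) by (auto simp: between_def)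
        ultimately show False using x(2) cos_self by blast
      qed
      then show "cos ` N \<subset> cos ` N'" using x N(3) by blast
    qed
  qed
  then show ?thesis
    unfolding quot_length_def module_length_def len_def chain_sup_def strict_chain_def Q_def by simp
qed

section \<open>Ideals of the form V + sum of a_j M and their filtrations\<close>

definition msum :: "'a set \<Rightarrow> ('i \<Rightarrow> 'a) \<Rightarrow> 'a set \<Rightarrow> 'i set \<Rightarrow> 'a set" where
  "msum V a M A = Idl (V \<union> (\<Union>j\<in>A. (\<lambda>g. a j \<otimes> g) ` M))"

lemma msum_carrier:
  assumes "ideal V R" "ideal M R" "\<And>j. j \<in> A \<Longrightarrow> a j \<in> carrier R"
  shows "V \<union> (\<Union>j\<in>A. (\<lambda>g. a j \<otimes> g) ` M) \<subseteq> carrier R"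
  using assms ideal.Icarr[OF assms(1)] ideal.Icarr[OF assms(2)] by auto

lemma msum_ideal:
  assumes "ideal V R" "ideal M R" "\<And>j. j \<in> A \<Longrightarrow> a j \<in> carrier R"
  shows "ideal (msum V a M A) R"
  unfolding msum_def by (rule genideal_ideal[OF msum_carrier[OF assms]])

lemma msum_gen:
  assumes "ideal V R" "ideal M R" "\<And>j. j \<in> A \<Longrightarrow> a j \<in> carrier R"
  shows "V \<subseteq> msum V a M A" "j \<in> A \<Longrightarrow> g \<in> M \<Longrightarrow> a j \<otimes> g \<in> msum V a M A"
  using genideal_self[OF msum_carrier[where a = a and A = A, OF assms]] unfolding msum_def by blast+

lemma msum_least:
  assumes "ideal L R" "V \<subseteq> L" "\<And>j g. j \<in> A \<Longrightarrow> g \<in> M \<Longrightarrow> a j \<otimes> g \<in> L"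
  shows "msum V a M A \<subseteq> L"
  unfolding msum_def by (rule genideal_minimal[OF assms(1)]) (use assms in blast)

lemma msum_empty:
  assumes "ideal V R" "ideal M R"
  shows "msum V a M {} = V"
  using msum_least[OF assms(1), of V "{}" M a] msum_gen(1)[OF assms, of "{}" a] by auto

lemma msum_insert:
  assumes "ideal V R" "ideal M R" "\<And>j. j \<in> insert b A \<Longrightarrow> a j \<in> carrier R"
  shows "msum V a M (insert b A) = adjoin (msum V a M A) (a b) M"
proof
  have T: "ideal (msum V a M A) R" "ideal (msum V a M (insert b A)) R"
    using assms by (auto intro!: msum_ideal)
  have gen: "V \<subseteq> msum V a M A" "\<And>j g. j \<in> A \<Longrightarrow> g \<in> M \<Longrightarrow> a j \<otimes> g \<in> msum V a M A"
    using msum_gen[OF assms(1,2), of A a] assms(3) by blast+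
  have ab: "a b \<in> carrier R" using assms(3) by blast
  have sub: "msum V a M A \<subseteq> adjoin (msum V a M A) (a b) M"
    by (rule subset_adjoin[OF T(1) assms(2) ab])
  show "msum V a M (insert b A) \<subseteq> adjoin (msum V a M A) (a b) M"
  proof (rule msum_least)
    show "ideal (adjoin (msum V a M A) (a b) M) R"
      by (rule adjoin_ideal[OF T(1) assms(2) ab])
    show "V \<subseteq> adjoin (msum V a M A) (a b) M" using gen sub by blast
    show "a j \<otimes> g \<in> adjoin (msum V a M A) (a b) M" if "j \<in> insert b A" "g \<in> M" for j g
      using that gen sub mult_mem_adjoin[OF T(1) assms(2) ab] by blast
  qed
  have gen': "V \<subseteq> msum V a M (insert b A)"
    "\<And>j g. j \<in> insert b A \<Longrightarrow> g \<in> M \<Longrightarrow> a j \<otimes> g \<in> msum V a M (insert b A)"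
    using msum_gen[OF assms(1,2), of "insert b A" a] assms(3) by blast+
  have "msum V a M A \<subseteq> msum V a M (insert b A)"
    by (rule msum_least[OF T(2)]) (use gen' in blast)+
  then show "adjoin (msum V a M A) (a b) M \<subseteq> msum V a M (insert b A)"
    using gen'(2)[of b] ideal_add[OF T(2)] by (auto simp: adjoin_def)
qed

lemma msum_mono:
  assumes "ideal V R" "ideal W R" "ideal M R" "\<And>j. j \<in> A \<Longrightarrow> a j \<in> carrier R" "V \<subseteq> W"
  shows "msum V a M A \<subseteq> msum W a M A"
proof (rule msum_least)
  note gen = msum_gen[where a = a and A = A, OF assms(2,3,4)]
  show "ideal (msum W a M A) R" by (rule msum_ideal[OF assms(2,3,4)])
  show "V \<subseteq> msum W a M A" using gen(1) assms(5) by blast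
  show "a j \<otimes> g \<in> msum W a M A" if "j \<in> A" "g \<in> M" for j g
    using gen(2) that by blast
qed

text \<open>The quotients of the filtration \<open>msum V a M {j \<in> A. j < i}\<close>, \<open>i \<in> A\<close>, are quotients of \<open>M\<close>.\<close>

lemma len_msum:
  fixes a :: "'i::linorder \<Rightarrow> 'a"
  assumes "ideal V R" "ideal M R" "finite A" "\<And>j. j \<in> A \<Longrightarrow> a j \<in> carrier R"
  shows "len V (msum V a M A) = (\<Sum>i\<in>A. len (colon M (a i) (msum V a M {j\<in>A. j < i})) M)"
  using assms(3,4)
proof (induction A rule: finite_linorder_max_induct)
  case empty
  then show ?case using assms by (simp add: msum_empty len_refl)
next
  case (insert b A)
  have carr: "\<And>j. j \<in> A \<Longrightarrow> a j \<in> carrier R" "a b \<in> carrier R"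
    using insert.prems by auto
  have T: "ideal (msum V a M A) R" by (rule msum_ideal[OF assms(1,2) carr(1)])
  have "b \<notin> A" using insert.hyps(2) by blast
  have below: "{j \<in> insert b A. j < i} = {j \<in> A. j < i}" if "i \<in> A" for i
    using insert.hyps(2) that by force
  have below_b: "{j \<in> insert b A. j < b} = A"
    using insert.hyps(2) by auto
  have "len V (msum V a M (insert b A)) = len V (adjoin (msum V a M A) (a b) M)"
    by (subst msum_insert[OF assms(1,2) insert.prems]) auto
  also have "\<dots> = len V (msum V a M A) + len (msum V a M A) (adjoin (msum V a M A) (a b) M)"
    by (intro len_add assms T adjoin_ideal carr msum_gen(1) subset_adjoin)
  also have "len (msum V a M A) (adjoin (msum V a M A) (a b) M)
      = len (colon M (a b) (msum V a M {j \<in> insert b A. j < b})) M"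
    unfolding below_b by (rule len_adjoin[OF T assms(2) carr(2)])
  also have "len V (msum V a M A)
      = (\<Sum>i\<in>A. len (colon M (a i) (msum V a M {j \<in> insert b A. j < i})) M)"
    proof -
    have "len V (msum V a M A) = (\<Sum>i\<in>A. len (colon M (a i) (msum V a M {j \<in> A. j < i})) M)"
      by (rule insert.IH) (rule carr(1))
    also have "\<dots> = (\<Sum>i\<in>A. len (colon M (a i) (msum V a M {j \<in> insert b A. j < i})) M)"
      by (rule sum.cong) (simp_all only: below)
    finally show ?thesis .
  qed
  finally show ?case
    using insert.hyps(1) \<open>b \<notin> A\<close> by (simp add: add.commute)
qed

text \<open>The division argument of Groebner theory: every leading coefficient of \<open>W\<close>
  is one of \<open>V\<close>. Write w = t + a_b g with b the largest index; g is a leading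
  coefficient for \<open>W\<close>, hence for \<open>V\<close>, so w already lies in the sum over
  the smaller indices, and the induction removes these too.\<close>

lemma msum_subset_of_colon_eq:
  fixes a :: "'i::linorder \<Rightarrow> 'a"
  assumes "ideal V R" "ideal W R" "ideal M R" "V \<subseteq> W" "finite A" "\<And>j. j \<in> A \<Longrightarrow> a j \<in> carrier R"
    and "\<And>i. i \<in> A \<Longrightarrow> colon M (a i) (msum W a M {j\<in>A. j < i}) \<subseteq> colon M (a i) (msum V a M {j\<in>A. j < i})"
  shows "W \<inter> msum V a M A \<subseteq> V"
  using assms(5-7)
proof (induction A rule: finite_linorder_max_induct)
  case empty
  then show ?case using assms by (simp add: msum_empty)
next
  case (insert b A)
  have carr: "\<And>j. j \<in> A \<Longrightarrow> a j \<in> carrier R" "a b \<in> carrier R"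
    using insert.prems by auto
  have T: "ideal (msum V a M A) R" by (rule msum_ideal[OF assms(1,3) carr(1)])
  have T': "ideal (msum W a M A) R" by (rule msum_ideal[OF assms(2,3) carr(1)])
  have VW: "msum V a M A \<subseteq> msum W a M A"
    by (rule msum_mono[OF assms(1,2,3) carr(1) assms(4)])
  have below: "{j \<in> insert b A. j < i} = {j \<in> A. j < i}" if "i \<in> A" for i
    using insert.hyps(2) that by force
  have below_b: "{j \<in> insert b A. j < b} = A"
    using insert.hyps(2) by auto
  have IH: "W \<inter> msum V a M A \<subseteq> V"
  proof (rule insert.IH[OF carr(1)])
    fix i assume "i \<in> A"
    then show "colon M (a i) (msum W a M {j\<in>A. j < i}) \<subseteq> colon M (a i) (msum V a M {j\<in>A. j < i})"
      using insert.prems(2)[of i] below by simp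
  qed
  show ?case
  proof
    fix w assume w: "w \<in> W \<inter> msum V a M (insert b A)"
    then have "w \<in> adjoin (msum V a M A) (a b) M"
      using msum_insert[OF assms(1,3) insert.prems(1), of b A] by simp
    then obtain t g where tg: "t \<in> msum V a M A" "g \<in> M" "w = t \<oplus> a b \<otimes> g"
      by (auto simp: adjoin_def)
    have "w \<in> msum W a M A" "t \<in> msum W a M A"
      using w tg(1) VW msum_gen(1)[where a = a and A = A, OF assms(2,3) carr(1)] by auto
    then have "a b \<otimes> g \<in> msum W a M A"
      using ideal_add_cancel[OF T', of t "a b \<otimes> g"] tg carr ideal.Icarr[OF assms(3)] by simp
    then have "g \<in> colon M (a b) (msum V a M A)"
      using insert.prems(2)[of b] tg(2) below_b by (auto simp: colon_def)
    then have "w \<in> msum V a M A"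
      using tg ideal_add[OF T] by (simp add: colon_def)
    then show "w \<in> V" using IH w by blast
  qed
qed

end

section \<open>Monomial filtrations and Hilbert functions\<close>

lemma enat_the_enat: "n \<noteq> \<infinity> \<Longrightarrow> enat (the_enat n) = n"
  by (cases n) auto

lemma map2_minus_add:
  fixes \<alpha> \<beta> :: "nat list"
  assumes "list_all2 (\<le>) \<alpha> \<beta>"
  shows "map2 (+) (map2 (-) \<beta> \<alpha>) \<alpha> = \<beta>" "length (map2 (-) \<beta> \<alpha>) = length \<alpha>"
  using assms by (induction rule: list_all2_induct) auto

lemma sum_list_map2_add:
  fixes \<alpha> \<beta> :: "nat list"
  assumes "length \<alpha> = length \<beta>"
  shows "sum_list (map2 (+) \<alpha> \<beta>) = sum_list \<alpha> + sum_list \<beta>"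
  using assms by (induction \<alpha> \<beta> rule: list_induct2) auto

text \<open>Compatibility of the lexicographic order with addition is the property of a monomial
  order on which multiplication of leading terms rests. Equal lengths keep \<open>map2\<close> from
  truncating.\<close>

lemma map2_add_strict_mono:
  fixes \<alpha> \<beta> \<gamma> :: "nat list"
  assumes "length \<gamma> = length \<alpha>" "length \<alpha> = length \<beta>" "\<alpha> < \<beta>"
  shows "map2 (+) \<gamma> \<alpha> < map2 (+) \<gamma> \<beta>"
  using assms by (induction \<gamma> \<alpha> \<beta> rule: list_induct3) auto

context cring
begin

primrec monomial :: "'a list \<Rightarrow> nat list \<Rightarrow> 'a" where
  "monomial [] \<alpha> = \<one>"
| "monomial (x # xs) \<alpha> = x [^] hd \<alpha> \<otimes> monomial xs (tl \<alpha>)"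

lemma monomial_closed: "set xs \<subseteq> carrier R \<Longrightarrow> monomial xs \<alpha> \<in> carrier R"
  by (induction xs arbitrary: \<alpha>) auto

lemma monomial_add:
  assumes "length xs = length \<alpha>" "length \<alpha> = length \<beta>" "set xs \<subseteq> carrier R"
  shows "monomial xs (map2 (+) \<alpha> \<beta>) = monomial xs \<alpha> \<otimes> monomial xs \<beta>"
  using assms
proof (induction xs \<alpha> \<beta> rule: list_induct3)
  case (Cons x xs a \<alpha> b \<beta>)
  then show ?case
    by (simp add: monomial_closed nat_pow_mult[symmetric] m_ac)
qed simp

lemma monomial_zero: "set xs \<subseteq> carrier R \<Longrightarrow> monomial xs (replicate (length xs) 0) = \<one>"
  by (induction xs) auto

lemma monomial_unit:
  assumes "x \<in> set xs" "set xs \<subseteq> carrier R"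
  shows "\<exists>\<epsilon>\<in>exponents (length xs) 1. monomial xs \<epsilon> = x"
  using assms
proof (induction xs)
  case (Cons y xs)
  show ?case
  proof (cases "x = y")
    case True
    then show ?thesis
      using Cons.prems monomial_zero[of xs]
      by (intro bexI[of _ "1 # replicate (length xs) 0"]) (auto simp: exponents_def sum_list_replicate)
  next
    case False
    then obtain \<epsilon> where "\<epsilon> \<in> exponents (length xs) 1" "monomial xs \<epsilon> = x"
      using Cons by auto
    then show ?thesis
      using Cons.prems by (intro bexI[of _ "0 # \<epsilon>"]) (auto simp: exponents_def)
  qed
qed simp

lemma monomial_split:
  assumes "\<alpha> \<in> exponents (length xs) (Suc n)" "set xs \<subseteq> carrier R"
  shows "\<exists>x\<in>set xs. \<exists>\<beta>\<in>exponents (length xs) n. monomial xs \<alpha> = x \<otimes> monomial xs \<beta>"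
  using assms
proof (induction xs arbitrary: \<alpha> n)
  case Nil
  then show ?case by (auto simp: exponents_def)
next
  case (Cons y xs)
  then obtain k \<alpha>' where \<alpha>: "\<alpha> = k # \<alpha>'" "length \<alpha>' = length xs" "k + sum_list \<alpha>' = Suc n"
    by (cases \<alpha>) (auto simp: exponents_def)
  show ?case
  proof (cases k)
    case 0
    then obtain x \<beta> where x: "x \<in> set xs" "\<beta> \<in> exponents (length xs) n"
        "monomial xs \<alpha>' = x \<otimes> monomial xs \<beta>"
      using Cons.IH[of \<alpha>' n] Cons.prems(2) \<alpha> by (auto simp: exponents_def)
    have "monomial (y # xs) \<alpha> = x \<otimes> monomial (y # xs) (0 # \<beta>)"
      using x \<alpha> 0 Cons.prems(2) monomial_closed[of xs] by (auto simp: subset_iff)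
    moreover have "0 # \<beta> \<in> exponents (length (y # xs)) n" using x by (auto simp: exponents_def)
    ultimately show ?thesis using x(1) by (metis list.set_intros(2))
  next
    case (Suc m)
    have "monomial (y # xs) \<alpha> = y \<otimes> monomial (y # xs) (m # \<alpha>')"
      using \<alpha> Suc Cons.prems(2) monomial_closed[of xs] by (simp add: nat_pow_Suc2 m_assoc m_lcomm)
    moreover have "m # \<alpha>' \<in> exponents (length (y # xs)) n"
      using \<alpha> Suc by (auto simp: exponents_def)
    ultimately show ?thesis by (metis list.set_intros(1))
  qed
qed

lemma colon_carrier_ideal:
  "ideal V R \<Longrightarrow> a \<in> carrier R \<Longrightarrow> ideal (colon (carrier R) a V) R"
  by (rule colon_ideal[OF oneideal])

section \<open>Products J^n M, their monomial generators and initial ideals\<close>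

definition ideal_mul :: "'a set \<Rightarrow> nat \<Rightarrow> 'a set \<Rightarrow> 'a set" where
  "ideal_mul J n M = ((ideal_prod R J) ^^ n) M"

lemma ideal_mul_0 [simp]: "ideal_mul J 0 M = M"
  by (simp add: ideal_mul_def)

lemma ideal_mul_Suc: "ideal_mul J (Suc n) M = ideal_prod R J (ideal_mul J n M)"
  by (simp add: ideal_mul_def)

lemma ideal_mul_Suc_right: "ideal_mul J (Suc n) M = ideal_mul J n (ideal_prod R J M)"
  by (simp add: ideal_mul_def funpow_swap1)

lemma ideal_mul_add: "ideal_mul J (m + n) M = ideal_mul J m (ideal_mul J n M)"
  by (simp add: ideal_mul_def funpow_add)

lemma ideal_power_eq_ideal_mul: "ideal_power R J n = ideal_mul J n (carrier R)"
  by (induction n) (simp_all add: ideal_mul_Suc)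

lemma ideal_mul_ideal: "ideal J R \<Longrightarrow> ideal M R \<Longrightarrow> ideal (ideal_mul J n M) R"
  by (induction n) (simp_all add: ideal_mul_Suc ideal_prod_is_ideal)

lemma ideal_prod_mono:
  assumes "M \<subseteq> N" shows "ideal_prod R J M \<subseteq> ideal_prod R J N"
proof
  fix x assume "x \<in> ideal_prod R J M"
  then show "x \<in> ideal_prod R J N"
    using assms by (induction rule: ideal_prod.induct) (auto intro: ideal_prod.intros)
qed

lemma ideal_mul_mono: "M \<subseteq> N \<Longrightarrow> ideal_mul J n M \<subseteq> ideal_mul J n N"
  by (induction n) (simp_all add: ideal_mul_Suc ideal_prod_mono)

lemma ideal_prod_least:
  assumes "ideal L R" "\<And>i j. i \<in> J \<Longrightarrow> j \<in> M \<Longrightarrow> i \<otimes> j \<in> L"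
  shows "ideal_prod R J M \<subseteq> L"
proof
  fix x assume "x \<in> ideal_prod R J M"
  then show "x \<in> L"
    by (induction rule: ideal_prod.induct) (auto intro: assms(2) ideal_add[OF assms(1)])
qed

lemma ideal_prod_subset: "ideal J R \<Longrightarrow> ideal M R \<Longrightarrow> ideal_prod R J M \<subseteq> M"
  by (rule ideal_prod_least) (auto intro: ideal.I_l_closed ideal.Icarr)

lemma ideal_mul_antimono:
  assumes "ideal J R" "ideal M R" "m \<le> n"
  shows "ideal_mul J n M \<subseteq> ideal_mul J m M"
  using assms(3)
proof (induction n rule: dec_induct)
  case (step n)
  then show ?case
    using ideal_prod_subset[OF assms(1) ideal_mul_ideal[OF assms(1,2), of n]]
    by (simp add: ideal_mul_Suc)
qed simp

text \<open>Since \<open>J\<close> is generated by \<open>xs\<close>, the monomials of degree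
  \<open>n\<close> in \<open>xs\<close> generate J^n. An ideal \<open>V\<close> inside J^n M can be
  added without effect, which matches the form of \<open>len_msum\<close>.\<close>

lemma ideal_mul_eq_msum:
  assumes xs: "set xs \<subseteq> carrier R" and J: "J = Idl (set xs)" and M: "ideal M R"
    and V: "ideal V R" "V \<subseteq> ideal_mul J n M"
  shows "msum V (monomial xs) M (exponents (length xs) n) = ideal_mul J n M"
proof -
  note mon = monomial_closed[OF xs]
  define S where "S n = msum {\<zero>} (monomial xs) M (exponents (length xs) n)" for n
  have S_ideal: "ideal (S n) R" for n
    unfolding S_def by (rule msum_ideal[OF zeroideal M mon])
  have S_gen: "monomial xs \<alpha> \<otimes> g \<in> S n" if "\<alpha> \<in> exponents (length xs) n" "g \<in> M" for \<alpha> g n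
    unfolding S_def by (rule msum_gen(2)[OF zeroideal M mon that])
  have J_ideal: "ideal J R" unfolding J by (rule genideal_ideal[OF xs])
  have xJ: "x \<in> J" if "x \<in> set xs" for x unfolding J using genideal_self[OF xs] that by blast
  have pow_ideal: "ideal (ideal_mul J n M) R" for n by (rule ideal_mul_ideal[OF J_ideal M])
  have eq: "S n = ideal_mul J n M" for n
  proof (induction n)
    case 0
    have "S 0 = M"
    proof
      show "S 0 \<subseteq> M"
        unfolding S_def
        by (rule msum_least[OF M])
          (use mon ideal.I_l_closed[OF M] ideal_zero[OF M] in \<open>auto simp: exponents_def\<close>)
      show "M \<subseteq> S 0"
      proof
        fix g assume g: "g \<in> M"
        have "monomial xs (replicate (length xs) 0) \<otimes> g \<in> S 0"
          by (rule S_gen[OF _ g]) (simp add: exponents_def sum_list_replicate)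
        then show "g \<in> S 0" using g ideal.Icarr[OF M g] by (simp add: monomial_zero[OF xs])
      qed
    qed
    then show ?case by simp
  next
    case (Suc n)
    have "ideal_prod R J (S n) \<subseteq> S (Suc n)"
    proof (rule ideal_prod_least[OF S_ideal])
      fix i s assume i: "i \<in> J" and s: "s \<in> S n"
      \<comment> \<open>Two colon ideals replace an expansion into sums: for a fixed generator x all
        s in \<open>S n\<close> are treated at once, then for a fixed s the statement passes from
        the generators to all of \<open>J\<close>.\<close>
      have "S n \<subseteq> colon (carrier R) x (S (Suc n))" if x: "x \<in> set xs" for x
        unfolding S_def[of n]
      proof (rule msum_least)
        have xc: "x \<in> carrier R" using x xs by blast
        show "ideal (colon (carrier R) x (S (Suc n))) R"
          by (rule colon_carrier_ideal[OF S_ideal xc])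
        then show "{\<zero>} \<subseteq> colon (carrier R) x (S (Suc n))" using ideal_zero by blast
        fix \<alpha> g assume \<alpha>: "\<alpha> \<in> exponents (length xs) n" and g: "g \<in> M"
        obtain \<epsilon> where \<epsilon>: "\<epsilon> \<in> exponents (length xs) 1" "monomial xs \<epsilon> = x"
          using monomial_unit[OF x xs] by blast
        have "map2 (+) \<epsilon> \<alpha> \<in> exponents (length xs) (Suc n)"
          using \<alpha> \<epsilon> by (simp add: exponents_def sum_list_map2_add)
        then have "monomial xs (map2 (+) \<epsilon> \<alpha>) \<otimes> g \<in> S (Suc n)" using g by (rule S_gen)
        moreover have "monomial xs (map2 (+) \<epsilon> \<alpha>) = x \<otimes> monomial xs \<alpha>"
          using \<alpha> \<epsilon> xs by (subst monomial_add) (auto simp: exponents_def)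
        ultimately show "monomial xs \<alpha> \<otimes> g \<in> colon (carrier R) x (S (Suc n))"
          using mon ideal.Icarr[OF M g] xc by (simp add: colon_def m_assoc)
      qed
      then have "x \<otimes> s \<in> S (Suc n)" if "x \<in> set xs" for x
        using that s by (auto simp: colon_def)
      then have "set xs \<subseteq> colon (carrier R) s (S (Suc n))"
        using xs ideal.Icarr[OF S_ideal s] by (auto simp: colon_def m_comm subset_iff)
      then have "J \<subseteq> colon (carrier R) s (S (Suc n))"
        unfolding J by (rule genideal_minimal[OF colon_carrier_ideal[OF S_ideal ideal.Icarr[OF S_ideal s]]])
      then show "i \<otimes> s \<in> S (Suc n)"
        using i ideal.Icarr[OF S_ideal s] ideal.Icarr[OF J_ideal i] by (auto simp: colon_def m_comm)
    qed
    moreover have "S (Suc n) \<subseteq> ideal_prod R J (S n)"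
      unfolding S_def[of "Suc n"]
    proof (rule msum_least)
      show I: "ideal (ideal_prod R J (S n)) R" by (rule ideal_prod_is_ideal[OF J_ideal S_ideal])
      show "{\<zero>} \<subseteq> ideal_prod R J (S n)" using ideal_zero[OF I] by blast
      fix \<alpha> g assume \<alpha>: "\<alpha> \<in> exponents (length xs) (Suc n)" and g: "g \<in> M"
      obtain x \<beta> where x: "x \<in> set xs" "\<beta> \<in> exponents (length xs) n"
          "monomial xs \<alpha> = x \<otimes> monomial xs \<beta>"
        using monomial_split[OF \<alpha> xs] by blast
      then have "monomial xs \<alpha> \<otimes> g = x \<otimes> (monomial xs \<beta> \<otimes> g)"
        using xs mon ideal.Icarr[OF M g] by (auto simp: m_assoc subset_iff)
      then show "monomial xs \<alpha> \<otimes> g \<in> ideal_prod R J (S n)"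
        using ideal_prod.prod[OF xJ[OF x(1)] S_gen[OF x(2) g], of R] by simp
    qed
    ultimately show ?case using Suc.IH by (simp add: ideal_mul_Suc)
  qed
  show ?thesis
  proof
    show "msum V (monomial xs) M (exponents (length xs) n) \<subseteq> ideal_mul J n M"
      by (rule msum_least[OF pow_ideal V(2)]) (use S_gen eq in auto)
    have "S n \<subseteq> msum V (monomial xs) M (exponents (length xs) n)"
      unfolding S_def by (rule msum_mono[OF zeroideal V(1) M mon]) (use ideal_zero[OF V(1)] in auto)
    then show "ideal_mul J n M \<subseteq> msum V (monomial xs) M (exponents (length xs) n)"
      by (simp add: eq)
  qed
qed

text \<open>The leading coefficients at \<open>\<alpha>\<close>: those g in \<open>M\<close> for
  which the term with exponent \<open>\<alpha>\<close> and coefficient g lies in the component of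
  \<open>V\<close> of that degree, up to lexicographically smaller terms. \<open>M\<close> modulo
  this ideal is isomorphic to one layer of J^n M modulo V n.\<close>

definition initial_ideal :: "'a list \<Rightarrow> 'a set \<Rightarrow> (nat \<Rightarrow> 'a set) \<Rightarrow> nat list \<Rightarrow> 'a set" where
  "initial_ideal xs M V \<alpha> = colon M (monomial xs \<alpha>)
     (msum (V (sum_list \<alpha>)) (monomial xs) M {\<beta> \<in> exponents (length xs) (sum_list \<alpha>). \<beta> < \<alpha>})"

lemma initial_ideal_ideal:
  assumes "set xs \<subseteq> carrier R" "ideal M R" "\<And>n. ideal (V n) R"
  shows "ideal (initial_ideal xs M V \<alpha>) R"
  unfolding initial_ideal_def
  by (intro colon_ideal msum_ideal assms monomial_closed)

text \<open>Multiplication by the monomial of \<beta> - \<alpha> preserves the order of the terms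
  and carries \<open>V\<close> into \<open>W\<close>. Two families are allowed because in the
  argument for integral closures the family itself grows with a further parameter.\<close>

lemma initial_ideal_mono:
  assumes xs: "set xs \<subseteq> carrier R" and M: "ideal M R"
    and V: "\<And>n. ideal (V n) R" and W: "\<And>n. ideal (W n) R"
    and stable: "\<And>\<gamma> n g. length \<gamma> = length xs \<Longrightarrow> g \<in> V n \<Longrightarrow>
      monomial xs \<gamma> \<otimes> g \<in> W (sum_list \<gamma> + n)"
    and \<alpha>\<beta>: "length \<alpha> = length xs" "list_all2 (\<le>) \<alpha> \<beta>"
  shows "initial_ideal xs M V \<alpha> \<subseteq> initial_ideal xs M W \<beta>"
proof
  note mon = monomial_closed[OF xs]
  define \<gamma> where "\<gamma> = map2 (-) \<beta> \<alpha>"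
  have \<beta>: "\<beta> = map2 (+) \<gamma> \<alpha>" and \<gamma>: "length \<gamma> = length xs"
    using map2_minus_add[OF \<alpha>\<beta>(2)] \<alpha>\<beta>(1) by (auto simp: \<gamma>_def)
  have sum\<beta>: "sum_list \<beta> = sum_list \<gamma> + sum_list \<alpha>"
    unfolding \<beta> by (rule sum_list_map2_add) (use \<gamma> \<alpha>\<beta> in simp)
  let ?A = "{\<delta> \<in> exponents (length xs) (sum_list \<alpha>). \<delta> < \<alpha>}"
  let ?B = "{\<delta> \<in> exponents (length xs) (sum_list \<beta>). \<delta> < \<beta>}"
  let ?T = "msum (W (sum_list \<beta>)) (monomial xs) M ?B"
  have T: "ideal ?T R" by (rule msum_ideal[OF W M mon])
  have mon_add: "monomial xs (map2 (+) \<gamma> \<delta>) = monomial xs \<gamma> \<otimes> monomial xs \<delta>"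
    if "length \<delta> = length xs" for \<delta>
    using that \<gamma> xs by (intro monomial_add) auto
  have sub: "msum (V (sum_list \<alpha>)) (monomial xs) M ?A \<subseteq> colon (carrier R) (monomial xs \<gamma>) ?T"
  proof (rule msum_least)
    show "ideal (colon (carrier R) (monomial xs \<gamma>) ?T) R"
      by (rule colon_carrier_ideal[OF T mon])
    show "V (sum_list \<alpha>) \<subseteq> colon (carrier R) (monomial xs \<gamma>) ?T"
    proof
      fix g assume g: "g \<in> V (sum_list \<alpha>)"
      have "W (sum_list \<beta>) \<subseteq> ?T" by (rule msum_gen(1)[OF W M mon])
      then show "g \<in> colon (carrier R) (monomial xs \<gamma>) ?T"
        using stable[OF \<gamma> g] ideal.Icarr[OF V g] by (auto simp: colon_def sum\<beta>)
    qed
    fix \<delta> g assume \<delta>: "\<delta> \<in> ?A" and g: "g \<in> M"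
    have "map2 (+) \<gamma> \<delta> < \<beta>"
      unfolding \<beta> using \<delta> \<gamma> \<alpha>\<beta> by (intro map2_add_strict_mono) (auto simp: exponents_def)
    moreover have "map2 (+) \<gamma> \<delta> \<in> exponents (length xs) (sum_list \<beta>)"
      using \<delta> \<gamma> by (simp add: exponents_def sum_list_map2_add sum\<beta>)
    ultimately have "monomial xs (map2 (+) \<gamma> \<delta>) \<otimes> g \<in> ?T"
      using g by (intro msum_gen(2)[OF W M mon]) auto
    then show "monomial xs \<delta> \<otimes> g \<in> colon (carrier R) (monomial xs \<gamma>) ?T"
      using \<delta> mon_add[of \<delta>] mon ideal.Icarr[OF M g]
      by (auto simp: colon_def exponents_def m_assoc)
  qed
  fix g assume g: "g \<in> initial_ideal xs M V \<alpha>"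
  then have gM: "g \<in> M" by (simp add: initial_ideal_def colon_def)
  have "monomial xs \<gamma> \<otimes> (monomial xs \<alpha> \<otimes> g) \<in> ?T"
    using g sub by (auto simp: initial_ideal_def colon_def)
  then have "monomial xs \<beta> \<otimes> g \<in> ?T"
    unfolding \<beta> using mon_add[OF \<alpha>\<beta>(1)] mon ideal.Icarr[OF M gM] by (simp add: m_assoc)
  then show "g \<in> initial_ideal xs M W \<beta>"
    using gM by (simp add: initial_ideal_def colon_def)
qed

lemma len_ideal_mul:
  assumes xs: "set xs \<subseteq> carrier R" and J: "J = Idl (set xs)" and M: "ideal M R"
    and V: "\<And>n. ideal (V n) R" "\<And>n. V n \<subseteq> ideal_mul J n M"
  shows "len (V n) (ideal_mul J n M)
    = (\<Sum>\<alpha>\<in>exponents (length xs) n. len (initial_ideal xs M V \<alpha>) M)"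
proof -
  have "len (V n) (ideal_mul J n M) = len (V n) (msum (V n) (monomial xs) M (exponents (length xs) n))"
    by (simp add: ideal_mul_eq_msum[OF xs J M V])
  also have "\<dots> = (\<Sum>\<alpha>\<in>exponents (length xs) n. len (colon M (monomial xs \<alpha>)
      (msum (V n) (monomial xs) M {\<beta>\<in>exponents (length xs) n. \<beta> < \<alpha>})) M)"
    by (rule len_msum[OF V(1) M finite_exponents]) (rule monomial_closed[OF xs])
  also have "\<dots> = (\<Sum>\<alpha>\<in>exponents (length xs) n. len (initial_ideal xs M V \<alpha>) M)"
  proof (rule sum.cong[OF refl])
    fix \<alpha> assume \<alpha>: "\<alpha> \<in> exponents (length xs) n"
    then have "sum_list \<alpha> = n" by (simp add: exponents_def)
    then show "len (colon M (monomial xs \<alpha>)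
      (msum (V n) (monomial xs) M {\<beta>\<in>exponents (length xs) n. \<beta> < \<alpha>})) M
      = len (initial_ideal xs M V \<alpha>) M"
      by (simp add: initial_ideal_def)
  qed
  finally show ?thesis .
qed

lemma monomial_mult_ideal_mul:
  assumes xs: "set xs \<subseteq> carrier R" and J: "J = Idl (set xs)" and M: "ideal M R"
    and \<gamma>: "length \<gamma> = length xs" and g: "g \<in> ideal_mul J n M"
  shows "monomial xs \<gamma> \<otimes> g \<in> ideal_mul J (sum_list \<gamma> + n) M"
proof -
  have J_ideal: "ideal J R" unfolding J by (rule genideal_ideal[OF xs])
  have N: "ideal (ideal_mul J n M) R" by (rule ideal_mul_ideal[OF J_ideal M])
  have "monomial xs \<gamma> \<otimes> g \<in> msum {\<zero>} (monomial xs) (ideal_mul J n M) (exponents (length xs) (sum_list \<gamma>))"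
    by (rule msum_gen(2)[OF zeroideal N monomial_closed[OF xs] _ g]) (simp add: exponents_def \<gamma>)
  also have "\<dots> = ideal_mul J (sum_list \<gamma>) (ideal_mul J n M)"
    using ideal_zero[OF ideal_mul_ideal[OF J_ideal N]]
    by (intro ideal_mul_eq_msum[OF xs J N zeroideal]) auto
  finally show ?thesis by (simp add: ideal_mul_add)
qed

text \<open>Every layer is a quotient of M/N, as \<open>N\<close> is contained in all initial ideals
  involved; there is one layer for each monomial of degree \<open>n\<close>.\<close>

lemma len_ideal_mul_le:
  assumes xs: "set xs \<subseteq> carrier R" and J: "J = Idl (set xs)" and M: "ideal M R"
    and N: "ideal N R" "N \<subseteq> M"
  shows "len (ideal_mul J n N) (ideal_mul J n M) \<le> of_nat (card (exponents (length xs) n)) * len N M"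
proof -
  have J_ideal: "ideal J R" unfolding J by (rule genideal_ideal[OF xs])
  define V where "V = (\<lambda>n. ideal_mul J n N)"
  have V: "\<And>n. ideal (V n) R" "\<And>n. V n \<subseteq> ideal_mul J n M"
    by (simp_all add: V_def ideal_mul_ideal[OF J_ideal N(1)] ideal_mul_mono[OF N(2)])
  have "N \<subseteq> initial_ideal xs M V \<alpha>" if \<alpha>: "\<alpha> \<in> exponents (length xs) n" for \<alpha>
  proof
    fix g assume g: "g \<in> N"
    have "monomial xs \<alpha> \<otimes> g \<in> V (sum_list \<alpha>)"
      unfolding V_def using monomial_mult_ideal_mul[OF xs J N(1), of \<alpha> g 0] \<alpha> g
      by (simp add: exponents_def)
    also have "V (sum_list \<alpha>) \<subseteq> msum (V (sum_list \<alpha>)) (monomial xs) M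
        {\<beta> \<in> exponents (length xs) (sum_list \<alpha>). \<beta> < \<alpha>}"
      by (rule msum_gen(1)[OF V(1) M monomial_closed[OF xs]])
    finally show "g \<in> initial_ideal xs M V \<alpha>"
      using g N(2) by (auto simp: initial_ideal_def colon_def)
  qed
  then have "len (V n) (ideal_mul J n M) \<le> (\<Sum>\<alpha>\<in>exponents (length xs) n. len N M)"
    unfolding len_ideal_mul[OF xs J M V] by (intro sum_mono len_mono) auto
  then show ?thesis by (simp add: V_def)
qed

end

section \<open>Hilbert functions over a Noetherian ring\<close>

lemma (in noetherian_ring) no_strict_ideal_chain:
  assumes "\<And>i. ideal (N i) R"
  shows "\<not> (\<forall>i::nat. N i \<subset> N (Suc i))"
proof
  assume inc: "\<forall>i::nat. N i \<subset> N (Suc i)"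
  have mono: "N i \<subseteq> N j" if "i \<le> j" for i j
    using that by (induction j rule: dec_induct) (use inc in blast)+
  have "subset.chain {I. ideal I R} (range N)"
    unfolding subset_chain_def
  proof (intro conjI ballI)
    fix A B assume "A \<in> range N" "B \<in> range N"
    then obtain i j where "A = N i" "B = N j" by blast
    then show "A \<subseteq> B \<or> B \<subseteq> A" using mono[of i j] mono[of j i] by (cases "i \<le> j") auto
  qed (use assms in blast)
  then have "\<Union>(range N) \<in> range N" by (intro ideal_chain_is_trivial) auto
  then obtain k where "\<Union>(range N) = N k" by blast
  then show False using inc by blast
qed

locale noetherian_cring = cring + noetherian_ring
begin

text \<open>\<open>the_enat\<close> is unspecified at infinity, so this carries information only for
  finite lengths; finiteness is proved alongside.\<close>

definition rlen :: "'a set \<Rightarrow> 'a set \<Rightarrow> real" where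
  "rlen K I = real (the_enat (len K I))"

text \<open>With V n = J^(n+1) M every initial ideal contains J M, which makes the layers finite.
  The initial ideals increase with the exponent vector, so the sum of their colengths in
  \<open>M\<close> is eventually polynomial.\<close>

lemma hilbert_function_ev_binomial:
  assumes xs: "set xs \<subseteq> carrier R" and J: "J = Idl (set xs)" and M: "ideal M R"
    and fin: "len (ideal_prod R J M) M \<noteq> \<infinity>"
  shows "ev_binomial (length xs) (\<lambda>n. rlen (ideal_mul J (Suc n) M) (ideal_mul J n M))"
    and "len (ideal_mul J (Suc n) M) (ideal_mul J n M) \<noteq> \<infinity>"
proof -
  have J_ideal: "ideal J R" unfolding J by (rule genideal_ideal[OF xs])
  define V where "V = (\<lambda>n. ideal_mul J (Suc n) M)"
  have V: "\<And>n. ideal (V n) R" "\<And>n. V n \<subseteq> ideal_mul J n M"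
    by (simp_all add: V_def ideal_mul_ideal[OF J_ideal M] ideal_mul_antimono[OF J_ideal M])
  have sub: "ideal_prod R J M \<subseteq> initial_ideal xs M V \<alpha>" if "length \<alpha> = length xs" for \<alpha>
  proof
    fix g assume g: "g \<in> ideal_prod R J M"
    have "monomial xs \<alpha> \<otimes> g \<in> V (sum_list \<alpha>)"
      unfolding V_def using monomial_mult_ideal_mul[OF xs J M that, of g 1] g
      by (simp add: ideal_mul_Suc)
    also have "V (sum_list \<alpha>) \<subseteq> msum (V (sum_list \<alpha>)) (monomial xs) M
        {\<beta> \<in> exponents (length xs) (sum_list \<alpha>). \<beta> < \<alpha>}"
      by (rule msum_gen(1)[OF V(1) M monomial_closed[OF xs]])
    finally show "g \<in> initial_ideal xs M V \<alpha>"
      using g ideal_prod_subset[OF J_ideal M] by (auto simp: initial_ideal_def colon_def)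
  qed
  have fin': "len (initial_ideal xs M V \<alpha>) M \<noteq> \<infinity>" if "length \<alpha> = length xs" for \<alpha>
    using len_mono[OF sub[OF that] subset_refl, of M] fin
    by (cases "len (initial_ideal xs M V \<alpha>) M") auto
  have sum: "len (ideal_mul J (Suc n) M) (ideal_mul J n M)
      = enat (\<Sum>\<alpha>\<in>exponents (length xs) n. the_enat (len (initial_ideal xs M V \<alpha>) M))" for n
  proof -
    have "len (ideal_mul J (Suc n) M) (ideal_mul J n M)
        = (\<Sum>\<alpha>\<in>exponents (length xs) n. len (initial_ideal xs M V \<alpha>) M)"
      using len_ideal_mul[OF xs J M V, of n] by (simp add: V_def)
    also have "\<dots> = (\<Sum>\<alpha>\<in>exponents (length xs) n. enat (the_enat (len (initial_ideal xs M V \<alpha>) M)))"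
      by (rule sum.cong) (use fin' in \<open>auto simp: exponents_def enat_the_enat\<close>)
    finally show ?thesis by (simp add: of_nat_eq_enat[symmetric])
  qed
  show "len (ideal_mul J (Suc n) M) (ideal_mul J n M) \<noteq> \<infinity>" by (simp add: sum)
  have "ev_binomial (length xs)
      (\<lambda>n. \<Sum>\<alpha>\<in>exponents (length xs) n. rlen (initial_ideal xs M V \<alpha>) M)"
  proof (rule ev_binomial_exponents[where w = "\<lambda>I. rlen I M"])
    fix \<alpha> \<beta> :: "nat list" assume "length \<alpha> = length xs" "list_all2 (\<le>) \<alpha> \<beta>"
    then show "initial_ideal xs M V \<alpha> \<subseteq> initial_ideal xs M V \<beta>"
      using monomial_mult_ideal_mul[OF xs J M]
      by (intro initial_ideal_mono[OF xs M V(1) V(1)]) (auto simp: V_def simp flip: add_Suc_right)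
  next
    fix g :: "nat \<Rightarrow> nat list"
    show "\<not> (\<forall>i. initial_ideal xs M V (g i) \<subset> initial_ideal xs M V (g (Suc i)))"
      by (rule no_strict_ideal_chain[OF initial_ideal_ideal[OF xs M V(1)]])
  qed
  then show "ev_binomial (length xs) (\<lambda>n. rlen (ideal_mul J (Suc n) M) (ideal_mul J n M))"
    unfolding sum rlen_def by simp
qed


section \<open>Integral closures of ideals\<close>

lemma ideal_power_ideal: "ideal K R \<Longrightarrow> ideal (ideal_power R K n) R"
  by (simp add: ideal_power_eq_ideal_mul ideal_mul_ideal oneideal)

lemma ideal_power_antimono: "ideal K R \<Longrightarrow> m \<le> n \<Longrightarrow> ideal_power R K n \<subseteq> ideal_power R K m"
  by (simp add: ideal_power_eq_ideal_mul ideal_mul_antimono oneideal)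

lemma ideal_prod_ideal_power:
  assumes "ideal K R"
  shows "ideal_prod R (ideal_power R K m) (ideal_power R K n) = ideal_power R K (m + n)"
proof (induction m)
  case 0
  then show ?case
    using ideal_prod_one[OF ideal_power_ideal[OF assms, of n]]
      ideal_prod_commute[OF oneideal ideal_power_ideal[OF assms, of n]] by simp
next
  case (Suc m)
  then show ?case
    using ideal_prod_assoc[OF assms ideal_power_ideal[OF assms] ideal_power_ideal[OF assms], of m n]
    by simp
qed

lemma mult_mem_ideal_power:
  assumes "ideal K R" "x \<in> ideal_power R K m" "y \<in> ideal_power R K n" "l \<le> m + n"
  shows "x \<otimes> y \<in> ideal_power R K l"
proof -
  have "x \<otimes> y \<in> ideal_power R K (m + n)"
    using ideal_prod.prod[OF assms(2,3), of R] ideal_prod_ideal_power[OF assms(1)] by simp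
  then show ?thesis using ideal_power_antimono[OF assms(1,4)] by blast
qed

lemma ideal_power_power:
  assumes "ideal K R"
  shows "ideal_power R (ideal_power R K n) m = ideal_power R K (n * m)"
  by (induction m) (simp_all add: ideal_prod_ideal_power[OF assms])

lemma pow_mem_ideal_power:
  assumes "ideal K R" "x \<in> K"
  shows "x [^] (m::nat) \<in> ideal_power R K m"
proof (induction m)
  case (Suc m)
  then show ?case
    using ideal_prod.prod[OF assms(2) Suc, of R] ideal.Icarr[OF assms] by (simp add: m_comm)
qed simp

lemma ideal_finsum:
  assumes "ideal I R" "\<And>i. i \<in> A \<Longrightarrow> f i \<in> I"
  shows "(\<Oplus>i\<in>A. f i) \<in> I"
  using assms(2)
proof (induction A rule: infinite_finite_induct)
  case (insert a A)
  then have "f \<in> A \<rightarrow> carrier R" "f a \<in> carrier R"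
    using ideal.Icarr[OF assms(1)] by auto
  then show ?case using insert ideal_add[OF assms(1)] by simp
qed (simp_all add: ideal_zero[OF assms(1)])

text \<open>\<open>c\<close> is the degree n of an equation for \<open>x\<close>. The equation
  expresses x^m through terms a_i x^(m-i) with a_i in K^i, so the loss of n in the exponent does not
  accumulate in the induction.\<close>

lemma integral_closure_pow_mem:
  assumes K: "ideal K R" and x: "x \<in> integral_closure R K"
  shows "\<exists>c. \<forall>m. x [^] (m::nat) \<in> ideal_power R K (m - c)"
proof -
  obtain n a where xc: "x \<in> carrier R" and n: "n \<ge> (1::nat)"
    and a: "\<And>i. i \<in> {1..n} \<Longrightarrow> a i \<in> ideal_power R K i"
    and eq: "x [^] n \<oplus> (\<Oplus>i\<in>{1..n}. a i \<otimes> x [^] (n - i)) = \<zero>"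
    using x unfolding integral_closure_def by blast
  have "x [^] m \<in> ideal_power R K (m - n)" for m :: nat
  proof (induction m rule: less_induct)
    case (less m)
    show ?case
    proof (cases "m \<le> n")
      case True
      then show ?thesis using xc by simp
    next
      case False
      \<comment> \<open>The elements y with x^(m-n) y in K^(m-n). They form an ideal, so the sum in
        the equation can be checked term by term.\<close>
      let ?T = "colon (carrier R) (x [^] (m - n)) (ideal_power R K (m - n))"
      have T: "ideal ?T R"
        using xc by (intro colon_carrier_ideal ideal_power_ideal K) simp
      let ?s = "\<Oplus>i\<in>{1..n}. a i \<otimes> x [^] (n - i)"
      have s: "?s \<in> ?T"
      proof (rule ideal_finsum[OF T])
        fix i assume i: "i \<in> {1..n}"
        then have ac: "a i \<in> carrier R" using a ideal.Icarr[OF ideal_power_ideal[OF K]] by blast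
        have "m - n + (n - i) = m - i" using i False by simp
        then have "x [^] (m - n) \<otimes> (a i \<otimes> x [^] (n - i)) = a i \<otimes> x [^] (m - i)"
          using xc ac by (simp add: m_lcomm nat_pow_mult)
        moreover have "a i \<otimes> x [^] (m - i) \<in> ideal_power R K (m - n)"
          using i False n by (intro mult_mem_ideal_power[OF K a[OF i] less[of "m - i"]]) auto
        ultimately show "a i \<otimes> x [^] (n - i) \<in> ?T"
          using xc ac by (simp add: colon_def)
      qed
      have "?s \<oplus> x [^] n = \<zero>"
        using eq a_comm[OF ideal.Icarr[OF T s], of "x [^] n"] xc by simp
      then have "x [^] n \<in> ?T"
        using ideal_add_cancel[OF T s, of "x [^] n"] xc ideal_zero[OF T] by simp
      then have "x [^] (m - n) \<otimes> x [^] n \<in> ideal_power R K (m - n)" by (simp add: colon_def)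
      then show ?thesis using xc False by (simp add: nat_pow_mult)
    qed
  qed
  then show ?thesis by blast
qed

end

context noetherian_cring
begin

section \<open>Growth criterion for integrality and its consequences\<close>

lemma finite_generators:
  assumes "ideal K R"
  obtains ys where "set ys \<subseteq> carrier R" "K = Idl (set ys)"
  using finetely_gen[OF assms] finite_list by metis

text \<open>The ideals \<open>D k m\<close> below are the homogeneous components of the \<open>R[Kt]\<close>-submodule of
  \<open>R[t]\<close> generated by \<open>1, zt, \<dots>, (zt)\<^sup>k\<close>. They lie in \<open>t\<^sup>c R[Kt]\<close> for a fixed \<open>c\<close>, so they
  stabilize in \<open>k\<close>, simultaneously for all \<open>m\<close>, and this makes \<open>zt\<close> integral over \<open>R[Kt]\<close>.\<close>

lemma mem_integral_closureI:
  assumes K: "ideal K R" and z: "z \<in> carrier R"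
    and pow: "\<And>m. z [^] (m::nat) \<in> ideal_power R K (m - c)"
  shows "z \<in> integral_closure R K"
proof -
  obtain ys where ys: "set ys \<subseteq> carrier R" and Kys: "K = Idl (set ys)"
    using finite_generators[OF K] .
  note carrK = ideal.Icarr[OF ideal_power_ideal[OF K]]
  define G where "G k m = {z [^] i \<otimes> b | i b. i \<le> k \<and> i \<le> m \<and> b \<in> ideal_power R K (m - i)}"
    for k m :: nat
  define D where "D k m = Idl (G k m)" for k m
  have G_carr: "G k m \<subseteq> carrier R" for k m
    unfolding G_def using z carrK by auto
  have D_ideal: "ideal (D k m) R" for k m
    unfolding D_def by (rule genideal_ideal[OF G_carr])
  have G_D: "G k m \<subseteq> D k m" for k m
    unfolding D_def by (rule genideal_self[OF G_carr])
  have D_pow: "D k m \<subseteq> ideal_power R K (m - c)" for k m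
    unfolding D_def
  proof (rule genideal_minimal[OF ideal_power_ideal[OF K]])
    show "G k m \<subseteq> ideal_power R K (m - c)"
      unfolding G_def using mult_mem_ideal_power[OF K pow] by auto
  qed
  have D_mono: "D k m \<subseteq> D k' m" if "k \<le> k'" for k k' m
    unfolding D_def[of k]
  proof (rule genideal_minimal[OF D_ideal])
    have "G k m \<subseteq> G k' m" unfolding G_def using that by fastforce
    then show "G k m \<subseteq> D k' m" using G_D by blast
  qed
  have D_mult: "monomial ys \<gamma> \<otimes> g \<in> D k (sum_list \<gamma> + m)"
    if \<gamma>: "length \<gamma> = length ys" and g: "g \<in> D k m" for \<gamma> g k m
  proof -
    have mc: "monomial ys \<gamma> \<in> carrier R" by (rule monomial_closed[OF ys])
    have "D k m \<subseteq> colon (carrier R) (monomial ys \<gamma>) (D k (sum_list \<gamma> + m))"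
      unfolding D_def[of k m]
    proof (rule genideal_minimal)
      show "ideal (colon (carrier R) (monomial ys \<gamma>) (D k (sum_list \<gamma> + m))) R"
        by (rule colon_carrier_ideal[OF D_ideal mc])
      show "G k m \<subseteq> colon (carrier R) (monomial ys \<gamma>) (D k (sum_list \<gamma> + m))"
      proof
        fix h assume "h \<in> G k m"
        then obtain i b where ib: "h = z [^] i \<otimes> b" "i \<le> k" "i \<le> m" "b \<in> ideal_power R K (m - i)"
          unfolding G_def by blast
        have "monomial ys \<gamma> \<otimes> b \<in> ideal_power R K (sum_list \<gamma> + (m - i))"
          using monomial_mult_ideal_mul[OF ys Kys oneideal \<gamma>] ib(4)
          by (simp add: ideal_power_eq_ideal_mul)
        then have "z [^] i \<otimes> (monomial ys \<gamma> \<otimes> b) \<in> G k (sum_list \<gamma> + m)"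
          unfolding G_def using ib(2,3)
          by (intro CollectI exI[of _ i] exI[of _ "monomial ys \<gamma> \<otimes> b"]) simp
        moreover have "monomial ys \<gamma> \<otimes> h = z [^] i \<otimes> (monomial ys \<gamma> \<otimes> b)"
          using ib z mc carrK by (simp add: m_lcomm)
        ultimately show "h \<in> colon (carrier R) (monomial ys \<gamma>) (D k (sum_list \<gamma> + m))"
          using G_D ib z carrK by (auto simp: colon_def)
      qed
    qed
    then show ?thesis using g by (auto simp: colon_def)
  qed
  \<comment> \<open>The head of the vector is the bound k on the powers of z, the tail an exponent
    vector in \<open>ys\<close>. The shift by \<open>c\<close> comes from \<open>D_pow\<close>: it
    places \<open>D k (j + c)\<close> inside K^j, to which the filtration by monomials of degree j
    applies.\<close>
  define f where "f \<alpha> = initial_ideal ys (carrier R) (\<lambda>j. D (hd \<alpha>) (j + c)) (tl \<alpha>)" for \<alpha>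
  have "\<exists>k0. \<forall>k \<alpha>. k0 \<le> k \<longrightarrow> length \<alpha> = length ys \<longrightarrow> f (k # \<alpha>) = f (k0 # \<alpha>)"
  proof (rule uniform_stabilization)
    fix \<alpha> \<beta> :: "nat list" assume "length \<alpha> = Suc (length ys)" "list_all2 (\<le>) \<alpha> \<beta>"
    then obtain k \<alpha>' k' \<beta>' where \<alpha>\<beta>: "\<alpha> = k # \<alpha>'" "\<beta> = k' # \<beta>'" "k \<le> k'"
        "length \<alpha>' = length ys" "list_all2 (\<le>) \<alpha>' \<beta>'"
      by (auto simp: list_all2_Cons1 length_Suc_conv)
    show "f \<alpha> \<le> f \<beta>"
      unfolding f_def \<alpha>\<beta>(1,2) list.sel
    proof (rule initial_ideal_mono[OF ys oneideal])
      show "monomial ys \<gamma> \<otimes> g \<in> D k' (sum_list \<gamma> + n + c)"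
        if "length \<gamma> = length ys" "g \<in> D k (n + c)" for \<gamma> n g
        using D_mult[OF that] D_mono[OF \<alpha>\<beta>(3)] by (auto simp: add.assoc)
    qed (use D_ideal \<alpha>\<beta> in auto)
  next
    fix g :: "nat \<Rightarrow> nat list"
    show "\<not> (\<forall>i. f (g i) < f (g (Suc i)))"
      unfolding f_def by (rule no_strict_ideal_chain[OF initial_ideal_ideal[OF ys oneideal D_ideal]])
  qed
  then obtain k0 where k0: "\<And>k \<alpha>. k0 \<le> k \<Longrightarrow> length \<alpha> = length ys \<Longrightarrow> f (k # \<alpha>) = f (k0 # \<alpha>)"
    by blast
  \<comment> \<open>Stability needs k >= k0; the summand \<open>c\<close> ensures n >= c, so that n
    - c + c = n. Going from n down to k = n-1 then expresses z^n by lower powers of z.\<close>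
  define k where "k = k0 + c"
  define n where "n = Suc k"
  let ?A = "exponents (length ys) (n - c)"
  have "D n n \<inter> msum (D k n) (monomial ys) (carrier R) ?A \<subseteq> D k n"
  proof (rule msum_subset_of_colon_eq)
    show "D k n \<subseteq> D n n" by (rule D_mono) (simp add: n_def)
    show "finite ?A" by (rule finite_exponents)
    fix \<alpha> assume \<alpha>: "\<alpha> \<in> ?A"
    have "f (n # \<alpha>) = f (k # \<alpha>)"
      using k0[of n \<alpha>] k0[of k \<alpha>] \<alpha> by (simp add: n_def k_def exponents_def)
    moreover have "sum_list \<alpha> = n - c" "n - c + c = n"
      using \<alpha> by (simp_all add: exponents_def n_def k_def)
    ultimately show "colon (carrier R) (monomial ys \<alpha>)
        (msum (D n n) (monomial ys) (carrier R) {j \<in> ?A. j < \<alpha>})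
      \<subseteq> colon (carrier R) (monomial ys \<alpha>)
        (msum (D k n) (monomial ys) (carrier R) {j \<in> ?A. j < \<alpha>})"
      by (simp add: f_def initial_ideal_def)
  qed (use D_ideal oneideal monomial_closed[OF ys] in auto)
  moreover have "msum (D k n) (monomial ys) (carrier R) ?A = ideal_power R K (n - c)"
    using ideal_mul_eq_msum[OF ys Kys oneideal D_ideal, of k n "n - c"] D_pow
    by (simp add: ideal_power_eq_ideal_mul)
  moreover have "z [^] n \<in> D n n"
  proof -
    have "z [^] n \<otimes> \<one> \<in> G n n" unfolding G_def
      by (intro CollectI exI[of _ n] exI[of _ \<one>]) simp
    then show ?thesis using G_D z by auto
  qed
  ultimately have zD: "z [^] n \<in> D k n" using D_pow by blast
  \<comment> \<open>An element of the generated ideal \<open>D k n\<close> is needed in the shape of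
    the equation, with one coefficient in K^(n-i) for each power z^i. Sums of this shape form an
    ideal that contains the generators.\<close>
  define E where "E = {(\<Oplus>i\<in>{..k}. z [^] i \<otimes> b i) | b. \<forall>i\<le>k. b i \<in> ideal_power R K (n - i)}"
  have fs: "(\<lambda>i. z [^] i \<otimes> b i) \<in> {..k} \<rightarrow> carrier R"
    if "\<forall>i\<le>k. b i \<in> ideal_power R K (n - i)" for b
    using that z carrK by auto
  have E_ideal: "ideal E R"
  proof (rule cidealI)
    show "E \<subseteq> carrier R" unfolding E_def using fs by (auto intro: finsum_closed)
    have "(\<Oplus>i\<in>{..k}. z [^] i \<otimes> \<zero>) = \<zero>"
      using z by (simp add: finsum_zero)
    then show "\<zero> \<in> E"
      unfolding E_def using ideal_zero[OF ideal_power_ideal[OF K]]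
      by (intro CollectI exI[of _ "\<lambda>_. \<zero>"]) simp
    fix x assume "x \<in> E"
    then obtain b where b: "x = (\<Oplus>i\<in>{..k}. z [^] i \<otimes> b i)" "\<forall>i\<le>k. b i \<in> ideal_power R K (n - i)"
      unfolding E_def by blast
    have bc: "\<And>i. i \<le> k \<Longrightarrow> b i \<in> carrier R" using b(2) carrK by blast
    {
      fix y assume "y \<in> E"
      then obtain b' where b': "y = (\<Oplus>i\<in>{..k}. z [^] i \<otimes> b' i)" "\<forall>i\<le>k. b' i \<in> ideal_power R K (n - i)"
        unfolding E_def by blast
      have bc': "\<And>i. i \<le> k \<Longrightarrow> b' i \<in> carrier R" using b'(2) carrK by blast
      have "x \<oplus> y = (\<Oplus>i\<in>{..k}. z [^] i \<otimes> b i \<oplus> z [^] i \<otimes> b' i)"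
        unfolding b(1) b'(1) by (rule finsum_addf[symmetric]) (use fs b b' in auto)
      also have "\<dots> = (\<Oplus>i\<in>{..k}. z [^] i \<otimes> (b i \<oplus> b' i))"
        by (rule finsum_cong') (use z bc bc' in \<open>auto simp: r_distr\<close>)
      finally show "x \<oplus> y \<in> E"
        unfolding E_def using b(2) b'(2) ideal_add[OF ideal_power_ideal[OF K]]
        by (intro CollectI exI[of _ "\<lambda>i. b i \<oplus> b' i"]) auto
    next
      fix r assume r: "r \<in> carrier R"
      have "r \<otimes> x = (\<Oplus>i\<in>{..k}. r \<otimes> (z [^] i \<otimes> b i))"
        unfolding b(1) by (rule finsum_rdistr) (use r fs b in auto)
      also have "\<dots> = (\<Oplus>i\<in>{..k}. z [^] i \<otimes> (r \<otimes> b i))"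
        by (rule finsum_cong') (use r z bc in \<open>auto simp: m_lcomm\<close>)
      finally show "r \<otimes> x \<in> E"
        unfolding E_def using b(2) r ideal.I_l_closed[OF ideal_power_ideal[OF K]]
        by (intro CollectI exI[of _ "\<lambda>i. r \<otimes> b i"]) auto
    }
  qed
  have "D k n \<subseteq> E"
    unfolding D_def
  proof (rule genideal_minimal[OF E_ideal], rule subsetI)
    fix h assume "h \<in> G k n"
    then obtain i b where ib: "h = z [^] i \<otimes> b" "i \<le> k" "b \<in> ideal_power R K (n - i)"
      unfolding G_def by blast
    have bc: "b \<in> carrier R" using ib carrK by blast
    have "(\<Oplus>j\<in>{..k}. z [^] j \<otimes> (if i = j then b else \<zero>))
        = (\<Oplus>j\<in>{..k}. if i = j then z [^] j \<otimes> b else \<zero>)"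
      by (rule finsum_cong') (use z bc in auto)
    also have "\<dots> = z [^] i \<otimes> b"
      using ib z bc by (intro add.finprod_singleton) auto
    finally show "h \<in> E"
      unfolding E_def using ib ideal_zero[OF ideal_power_ideal[OF K]]
      by (intro CollectI exI[of _ "\<lambda>j. if i = j then b else \<zero>"]) auto
  qed
  then have "\<ominus> (z [^] n) \<in> E" using zD ideal_minus[OF E_ideal] by blast
  then obtain b where b: "\<ominus> (z [^] n) = (\<Oplus>i\<in>{..k}. z [^] i \<otimes> b i)"
      "\<forall>i\<le>k. b i \<in> ideal_power R K (n - i)"
    unfolding E_def by blast
  have bc: "\<And>i. i \<le> k \<Longrightarrow> b i \<in> carrier R" using b(2) carrK by blast
  \<comment> \<open>The index is reversed: the coefficient of z^(n-i) lies in K^i, and i = 0 does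
    not occur because k < n.\<close>
  define a where "a i = b (n - i)" for i
  have img: "(\<lambda>i. n - i) ` {1..n} = {..k}"
  proof
    show "{..k} \<subseteq> (\<lambda>i. n - i) ` {1..n}"
    proof
      fix i assume "i \<in> {..k}"
      then have "i = n - (n - i)" "n - i \<in> {1..n}" by (auto simp: n_def)
      then show "i \<in> (\<lambda>i. n - i) ` {1..n}" by blast
    qed
  qed (auto simp: n_def)
  note b(1)
  also have "(\<Oplus>i\<in>{..k}. z [^] i \<otimes> b i) = (\<Oplus>i\<in>{1..n}. z [^] (n - i) \<otimes> b (n - i))"
    unfolding img[symmetric]
    by (rule add.finprod_reindex) (use fs[OF b(2)] img in \<open>auto simp: inj_on_def\<close>)
  also have "\<dots> = (\<Oplus>i\<in>{1..n}. a i \<otimes> z [^] (n - i))"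
    unfolding a_def by (rule finsum_cong') (use z bc in \<open>auto simp: n_def m_comm\<close>)
  finally have "(\<Oplus>i\<in>{1..n}. a i \<otimes> z [^] (n - i)) = \<ominus> (z [^] n)" by (rule sym)
  then have "z [^] n \<oplus> (\<Oplus>i\<in>{1..n}. a i \<otimes> z [^] (n - i)) = \<zero>"
    using z by (simp only: r_neg nat_pow_closed)
  moreover have "\<forall>i\<in>{1..n}. a i \<in> ideal_power R K i"
  proof
    fix i assume "i \<in> {1..n}"
    then have "n - i \<le> k" "n - (n - i) = i" by (auto simp: n_def)
    then show "a i \<in> ideal_power R K i" using b(2) by (metis a_def)
  qed
  moreover have "n \<ge> 1" by (simp add: n_def)
  ultimately show ?thesis
    unfolding integral_closure_def using z by blast
qed

lemma mem_integral_closure_iff: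
  assumes "ideal K R"
  shows "x \<in> integral_closure R K \<longleftrightarrow>
    x \<in> carrier R \<and> (\<exists>c. \<forall>m::nat. x [^] m \<in> ideal_power R K (m - c))"
proof -
  have "x \<in> carrier R" if "x \<in> integral_closure R K"
    using that by (simp add: integral_closure_def)
  then show ?thesis
    using mem_integral_closureI[OF assms] integral_closure_pow_mem[OF assms] by blast
qed

lemma integral_closure_ideal:
  assumes K: "ideal K R"
  shows "ideal (integral_closure R K) R"
proof (rule cidealI)
  note iff = mem_integral_closure_iff[OF K]
  show "integral_closure R K \<subseteq> carrier R" by (auto simp: integral_closure_def)
  have "\<zero> [^] m \<in> ideal_power R K (m - 0)" for m :: nat
    using pow_mem_ideal_power[OF K ideal_zero[OF K], of m] by (simp only: diff_zero)
  then show "\<zero> \<in> integral_closure R K" unfolding iff by blast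
  fix x assume "x \<in> integral_closure R K"
  then obtain c where x: "x \<in> carrier R" "\<And>m::nat. x [^] m \<in> ideal_power R K (m - c)"
    unfolding iff by blast
  {
    fix y assume "y \<in> integral_closure R K"
    then obtain c' where y: "y \<in> carrier R" "\<And>m::nat. y [^] m \<in> ideal_power R K (m - c')"
      unfolding iff by blast
    \<comment> \<open>A binomial expansion that never names its coefficients: with the factor x^i
      y^j carried along, the step from m to m+1 splits into two instances for m. The constants of x
      and y add up.\<close>
    have "(x \<oplus> y) [^] m \<otimes> (x [^] i \<otimes> y [^] j) \<in> ideal_power R K (m + i + j - (c + c'))"
      for m i j :: nat
    proof (induction m arbitrary: i j)
      case 0
      have "x [^] i \<otimes> y [^] j \<in> ideal_power R K (i + j - (c + c'))"
        by (rule mult_mem_ideal_power[OF K x(2) y(2)]) simp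
      then show ?case using x y by simp
    next
      case (Suc m)
      have "(x \<oplus> y) [^] Suc m \<otimes> (x [^] i \<otimes> y [^] j)
          = (x \<oplus> y) [^] m \<otimes> (x [^] Suc i \<otimes> y [^] j) \<oplus> (x \<oplus> y) [^] m \<otimes> (x [^] i \<otimes> y [^] Suc j)"
        using x y by (simp add: l_distr r_distr m_ac)
      also have "\<dots> \<in> ideal_power R K (Suc m + i + j - (c + c'))"
        using Suc[of "Suc i" j] Suc[of i "Suc j"]
        by (intro ideal_add[OF ideal_power_ideal[OF K]]) simp_all
      finally show ?case .
    qed
    from this[of _ 0 0] have "\<And>m. (x \<oplus> y) [^] (m::nat) \<in> ideal_power R K (m - (c + c'))"
      using x y by simp
    then show "x \<oplus> y \<in> integral_closure R K" unfolding iff using x y by blast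
  next
    fix r assume r: "r \<in> carrier R"
    have "(r \<otimes> x) [^] m \<in> ideal_power R K (m - c)" for m :: nat
      using r x ideal.I_l_closed[OF ideal_power_ideal[OF K] x(2)] by (simp add: nat_pow_distrib)
    then show "r \<otimes> x \<in> integral_closure R K" unfolding iff using r x by blast
  }
qed

lemma subset_integral_closure:
  assumes "ideal K R"
  shows "K \<subseteq> integral_closure R K"
proof
  fix x assume "x \<in> K"
  then have "x \<in> carrier R" "\<And>m::nat. x [^] m \<in> ideal_power R K (m - 0)"
    using ideal.Icarr[OF assms] pow_mem_ideal_power[OF assms] by auto
  then show "x \<in> integral_closure R K" unfolding mem_integral_closure_iff[OF assms] by blast
qed

lemma ideal_prod_integral_closure_power:
  assumes J: "ideal J R"
  shows "ideal_prod R J (integral_closure R (ideal_power R J n))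
    \<subseteq> integral_closure R (ideal_power R J (Suc n))"
proof (rule ideal_prod_least)
  note I = ideal_power_ideal[OF J]
  show "ideal (integral_closure R (ideal_power R J (Suc n))) R"
    by (rule integral_closure_ideal[OF I])
  fix j x assume j: "j \<in> J" and "x \<in> integral_closure R (ideal_power R J n)"
  then obtain c where x: "x \<in> carrier R" "\<And>m::nat. x [^] m \<in> ideal_power R J (n * (m - c))"
    unfolding mem_integral_closure_iff[OF I] ideal_power_power[OF J] by blast
  have jc: "j \<in> carrier R" by (rule ideal.Icarr[OF J j])
  \<comment> \<open>The exponents m from j^m and n(m-c) from x^m add up to at least (n+1)(m-c), so
    the constant \<open>c\<close> of x is kept.\<close>
  have "(j \<otimes> x) [^] m \<in> ideal_power R J (Suc n * (m - c))" for m :: nat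
  proof -
    have "j [^] m \<otimes> x [^] m \<in> ideal_power R J (Suc n * (m - c))"
      by (rule mult_mem_ideal_power[OF J pow_mem_ideal_power[OF J j] x(2)]) simp
    then show ?thesis using jc x by (simp add: nat_pow_distrib)
  qed
  then show "j \<otimes> x \<in> integral_closure R (ideal_power R J (Suc n))"
    unfolding mem_integral_closure_iff[OF I] ideal_power_power[OF J] using jc x by blast
qed

section \<open>Ideals of finite colength\<close>

lemma maximal_element:
  assumes "S \<noteq> {}" "\<And>I. I \<in> S \<Longrightarrow> ideal I R"
  shows "\<exists>M\<in>S. \<forall>I\<in>S. \<not> M \<subset> I"
proof (rule ccontr)
  assume "\<not> ?thesis"
  then obtain g where g: "\<And>M. M \<in> S \<Longrightarrow> g M \<in> S \<and> M \<subset> g M" by metis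
  obtain I where I: "I \<in> S" using assms(1) by blast
  define N where "N i = (g ^^ i) I" for i
  have "N i \<in> S" for i by (induction i) (use I g in \<open>auto simp: N_def\<close>)
  then have "\<forall>i. N i \<subset> N (Suc i)" "\<And>i. ideal (N i) R"
    using g assms(2) by (auto simp: N_def)
  then show False using no_strict_ideal_chain by blast
qed

lemma proper_ideal_subset_maximalideal:
  assumes "ideal I R" "I \<noteq> carrier R"
  obtains M where "maximalideal M R" "I \<subseteq> M"
proof -
  define S where "S = {K. ideal K R \<and> I \<subseteq> K \<and> K \<noteq> carrier R}"
  have "\<exists>M\<in>S. \<forall>K\<in>S. \<not> M \<subset> K"
    by (rule maximal_element) (use assms in \<open>auto simp: S_def\<close>)
  then obtain M where M: "M \<in> S" "\<And>K. K \<in> S \<Longrightarrow> \<not> M \<subset> K" by blast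
  have "maximalideal M R"
  proof (rule maximalidealI)
    show "ideal M R" "carrier R \<noteq> M" using M by (auto simp: S_def)
    show "K = M \<or> K = carrier R" if "ideal K R" "M \<subseteq> K" "K \<subseteq> carrier R" for K
      using M that unfolding S_def by blast
  qed
  then show ?thesis using that M(1) by (auto simp: S_def)
qed

text \<open>Noetherian induction: let I be maximal among the ideals above \<open>J\<close> of
  infinite colength. It is not \<mm>, so some a in \<mm> lies outside I. With a^p the last power
  before a first enters I, both I + (a^p) and I : a^p are properly larger, the latter because it
  contains a. Their finite colengths add up to that of I.\<close>

lemma len_finite_of_radical:
  assumes local: "maximalideal \<mm> R" "\<And>M. maximalideal M R \<Longrightarrow> M = \<mm>"
    and J: "ideal J R" and rad: "\<mm> \<subseteq> ideal_radical R J"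
  shows "len J (carrier R) \<noteq> \<infinity>"
proof
  assume inf: "len J (carrier R) = \<infinity>"
  define S where "S = {I. ideal I R \<and> J \<subseteq> I \<and> len I (carrier R) = \<infinity>}"
  have "\<exists>I\<in>S. \<forall>K\<in>S. \<not> I \<subset> K"
    by (rule maximal_element) (use J inf in \<open>auto simp: S_def\<close>)
  then obtain I where I: "I \<in> S" "\<And>K. K \<in> S \<Longrightarrow> \<not> I \<subset> K" by blast
  have id: "ideal I R" "J \<subseteq> I" "len I (carrier R) = \<infinity>" using I by (auto simp: S_def)
  have larger: "len K (carrier R) \<noteq> \<infinity>" if "ideal K R" "I \<subset> K" for K
  proof -
    have "J \<subseteq> K" using that id(2) by blast
    then show ?thesis using I(2)[of K] that by (auto simp: S_def)
  qed
  have proper: "I \<noteq> carrier R" using id len_refl by auto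
  have mm: "ideal \<mm> R" using local(1) by (simp add: maximalideal_def)
  have I_mm: "I \<subseteq> \<mm>"
    using proper_ideal_subset_maximalideal[OF id(1) proper] local(2) by metis
  have "len \<mm> (carrier R) \<le> enat 1"
    unfolding len_def
  proof (rule chain_sup_least, rule ccontr)
    fix n N assume N: "strict_chain (between \<mm> (carrier R)) n N" and "\<not> enat n \<le> enat 1"
    then have "0 < n" "1 < n" by auto
    then have "N 0 \<subset> N 1" "N 1 \<subset> N 2" "N 1 \<in> between \<mm> (carrier R)"
        "N 0 \<in> between \<mm> (carrier R)" "N 2 \<in> between \<mm> (carrier R)"
      using N by (auto simp: strict_chain_def numeral_2_eq_2)
    then show False
      using maximalideal.I_maximal[OF local(1), of "N 1"] by (auto simp: between_def)
  qed
  then have "I \<noteq> \<mm>" using id(3) by auto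
  then obtain a where a: "a \<in> \<mm>" "a \<notin> I" using I_mm by blast
  have ac: "a \<in> carrier R" by (rule ideal.Icarr[OF mm a(1)])
  have ex: "\<exists>n::nat. a [^] n \<in> I" using a rad id(2) by (auto simp: ideal_radical_def)
  define n where "n = (LEAST n::nat. a [^] n \<in> I)"
  have n: "a [^] n \<in> I" unfolding n_def by (rule LeastI_ex[OF ex])
  have "n \<noteq> 0" using n ideal.one_imp_carrier[OF id(1)] proper by auto
  then obtain p where p: "n = Suc p" by (cases n) auto
  have b: "a [^] p \<notin> I" using not_less_Least[of p "\<lambda>n. a [^] n \<in> I"] p by (simp add: n_def)
  have bc: "a [^] p \<in> carrier R" using ac by simp
  let ?I' = "adjoin I (a [^] p) (carrier R)" and ?C = "colon (carrier R) (a [^] p) I"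
  have I': "ideal ?I' R" "I \<subseteq> ?I'"
    by (rule adjoin_ideal[OF id(1) oneideal bc], rule subset_adjoin[OF id(1) oneideal bc])
  have "a [^] p \<otimes> \<one> \<in> ?I'" by (rule mult_mem_adjoin[OF id(1) oneideal bc]) simp
  then have "I \<subset> ?I'" using b bc I' by auto
  then have fin1: "len ?I' (carrier R) \<noteq> \<infinity>" using larger I' by blast
  have "ideal ?C R" by (rule colon_carrier_ideal[OF id(1) bc])
  moreover have "a \<in> ?C" using n p ac by (simp add: colon_def)
  moreover have "I \<subseteq> ?C"
    using ideal.I_l_closed[OF id(1) _ bc] ideal.Icarr[OF id(1)] by (auto simp: colon_def)
  ultimately have "len ?C (carrier R) \<noteq> \<infinity>" using larger a by blast
  then have "len I ?I' \<noteq> \<infinity>" using len_adjoin[OF id(1) oneideal bc] by simp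
  moreover have "len I (carrier R) = len I ?I' + len ?I' (carrier R)"
    by (rule len_add[OF id(1) I'(1) oneideal I'(2) ideal_subset[OF I'(1)]])
  ultimately show False using fin1 id(3) by (auto simp: plus_eq_infty_iff_enat)
qed

end

section \<open>Comparison of the two Hilbert polynomials\<close>

text \<open>Stars and bars gives the count binom(i+d-1, d-1), which is monotone in i; its value at
  \<open>n\<close> is a common bound for all steps of the chain of closures.\<close>

lemma card_exponents_le:
  assumes "d \<ge> 1" "i \<le> n"
  shows "card (exponents d i) \<le> (n + (d - 1)) choose (d - 1)"
proof -
  have "card (exponents d i) = (i + (d - 1)) choose i"
    using card_length_sum_list[of d i] assms(1) by (simp add: exponents_def)
  also have "\<dots> = (i + (d - 1)) choose (d - 1)"
    using binomial_symmetric[of i "i + (d - 1)"] by simp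
  also have "\<dots> \<le> (n + (d - 1)) choose (d - 1)"
    using assms(2) by (intro binomial_right_mono) simp
  finally show ?thesis .
qed

text \<open>Bounded partial sums of naturals attain a maximum, after which every further term is
  zero.\<close>

lemma nat_partial_sums_bounded:
  fixes w :: "nat \<Rightarrow> nat" and S :: real
  assumes "\<And>N. real (\<Sum>m<N. w m) \<le> S"
  shows "\<exists>N0. \<forall>m\<ge>N0. w m = 0"
proof -
  define s where "s N = (\<Sum>m<N. w m)" for N
  have bound: "s N \<le> nat \<lceil>S\<rceil>" for N
    using assms[of N] unfolding s_def by linarith
  obtain N0 where N0: "\<And>N. s N \<le> s N0"
    using ex_has_greatest_nat[of "\<lambda>_. True" 0 s "Suc (nat \<lceil>S\<rceil>)"] bound by (auto simp: less_Suc_eq_le)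
  have "mono s" by (rule incseq_SucI) (simp add: s_def)
  then have "w m = 0" if "m \<ge> N0" for m
    using N0[of "Suc m"] monoD[of s N0 m] that by (simp add: s_def)
  then show ?thesis by blast
qed

text \<open>The error has index d-1, so \<open>leading_coeff_nonpos\<close> applies in both
  directions at index \<open>d\<close> and the top coefficient of the difference \<open>a\<close>
  vanishes. Only then is d-1 the leading index, to which the same lemma applies again.\<close>

lemma second_coeff_le:
  fixes c c' :: "nat \<Rightarrow> real"
  assumes d: "d \<ge> 1"
    and le: "\<forall>\<^sub>F n in sequentially. (\<Sum>i<Suc d. c' i * real ((n + i) choose i))
      \<le> (\<Sum>i<Suc d. c i * real ((n + i) choose i))"
    and ge: "\<forall>\<^sub>F n in sequentially. (\<Sum>i<Suc d. c i * real ((n + i) choose i))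
      \<le> (\<Sum>i<Suc d. c' i * real ((n + i) choose i)) + S * real ((n + (d - 1)) choose (d - 1))"
  shows "c (d - 1) \<le> S + c' (d - 1)"
proof -
  define a where "a i = c i - c' i - (if i = d - 1 then S else 0)" for i
  have sum_a: "(\<Sum>i\<le>d. a i * real ((n + i) choose i))
      = (\<Sum>i<Suc d. c i * real ((n + i) choose i)) - (\<Sum>i<Suc d. c' i * real ((n + i) choose i))
        - S * real ((n + (d - 1)) choose (d - 1))" for n
  proof -
    have "(\<Sum>i\<le>d. (if i = d - 1 then S else 0) * real ((n + i) choose i))
        = (\<Sum>i\<le>d. if i = d - 1 then S * real ((n + i) choose i) else 0)"
      by (rule sum.cong) auto
    also have "\<dots> = S * real ((n + (d - 1)) choose (d - 1))" by simp
    finally show ?thesis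
      by (simp add: a_def left_diff_distrib sum_subtractf lessThan_Suc_atMost)
  qed
  have ev: "\<forall>\<^sub>F n in sequentially. (\<Sum>i\<le>d. a i * real ((n + i) choose i)) \<le> 0"
    using ge by eventually_elim (simp add: sum_a)
  have "\<forall>\<^sub>F n in sequentially. (\<Sum>i\<le>d. (c' i - c i) * real ((n + i) choose i)) \<le> 0"
    using le by eventually_elim (simp add: left_diff_distrib sum_subtractf lessThan_Suc_atMost)
  then have "c' d - c d \<le> 0" by (rule leading_coeff_nonpos)
  moreover have "a d \<le> 0" using ev by (rule leading_coeff_nonpos)
  ultimately have "a d = 0" using d by (cases d) (simp_all add: a_def)
  moreover obtain D where D: "d = Suc D" using d by (cases d) auto
  ultimately have "\<forall>\<^sub>F n in sequentially. (\<Sum>i\<le>D. a i * real ((n + i) choose i)) \<le> 0"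
    using ev by simp
  then have "a D \<le> 0" by (rule leading_coeff_nonpos)
  then show ?thesis using D by (simp add: a_def)
qed

context noetherian_cring
begin

section \<open>Hilbert polynomials and the refined chain of closures\<close>

lemma len_ideal_mul_sum:
  assumes "ideal J R" "ideal M R"
  shows "len (ideal_mul J n M) M = (\<Sum>i<n. len (ideal_mul J (Suc i) M) (ideal_mul J i M))"
proof (induction n)
  case (Suc n)
  have "len (ideal_mul J (Suc n) M) M
      = len (ideal_mul J (Suc n) M) (ideal_mul J n M) + len (ideal_mul J n M) M"
    using ideal_mul_antimono[OF assms, of n "Suc n"] ideal_mul_antimono[OF assms, of 0 n]
    by (intro len_add ideal_mul_ideal assms) simp_all
  then show ?case using Suc by (simp add: add.commute)
qed (simp add: len_refl)

lemma hilbert_polynomial: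
  assumes xs: "set xs \<subseteq> carrier R" and J: "J = Idl (set xs)" and M: "ideal M R"
    and fin: "len (ideal_prod R J M) M \<noteq> \<infinity>"
  shows "ev_binomial (Suc (length xs)) (\<lambda>n. rlen (ideal_mul J (Suc n) M) M)"
    and "len (ideal_mul J n M) M \<noteq> \<infinity>"
proof -
  have J_ideal: "ideal J R" unfolding J by (rule genideal_ideal[OF xs])
  let ?l = "\<lambda>i. len (ideal_mul J (Suc i) M) (ideal_mul J i M)"
  have sum: "len (ideal_mul J n M) M = enat (\<Sum>i<n. the_enat (?l i))" for n
  proof -
    have "len (ideal_mul J n M) M = (\<Sum>i<n. enat (the_enat (?l i)))"
      unfolding len_ideal_mul_sum[OF J_ideal M]
      by (rule sum.cong) (simp_all add: enat_the_enat hilbert_function_ev_binomial(2)[OF assms])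
    then show ?thesis by (simp add: of_nat_eq_enat[symmetric])
  qed
  show "len (ideal_mul J n M) M \<noteq> \<infinity>" by (simp add: sum)
  have "rlen (ideal_mul J (Suc n) M) M
      = (\<Sum>i\<le>n. rlen (ideal_mul J (Suc i) M) (ideal_mul J i M))" for n
    unfolding rlen_def[of "ideal_mul J (Suc n) M" M] sum
    by (simp add: rlen_def lessThan_Suc_atMost)
  then show "ev_binomial (Suc (length xs)) (\<lambda>n. rlen (ideal_mul J (Suc n) M) M)"
    using ev_binomial_partial_sums[OF hilbert_function_ev_binomial(1)[OF assms]] by simp
qed

text \<open>The filtration \<open>F N \<supseteq> J F (N - 1) \<supseteq> J\<^sup>2 F (N - 2) \<supseteq> \<dots> \<supseteq> J\<^sup>N\<close>.\<close>

lemma len_filtration_le: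
  assumes xs: "set xs \<subseteq> carrier R" and J: "J = Idl (set xs)" and d: "length xs \<ge> 1"
    and F: "\<And>n. ideal (F n) R" "\<And>n. ideal_prod R J (F n) \<subseteq> F (Suc n)"
  shows "len (ideal_mul J (Suc n) (F 0)) (F (Suc n))
    \<le> of_nat ((n + (length xs - 1)) choose (length xs - 1))
      * (\<Sum>m\<le>n. len (ideal_prod R J (F m)) (F (Suc m)))"
proof -
  have J_ideal: "ideal J R" unfolding J by (rule genideal_ideal[OF xs])
  let ?b = "of_nat ((n + (length xs - 1)) choose (length xs - 1)) :: enat"
  define L where "L m = ideal_mul J (Suc n - m) (F m)" for m
  have L_ideal: "ideal (L m) R" for m
    unfolding L_def by (rule ideal_mul_ideal[OF J_ideal F(1)])
  \<comment> \<open>Both neighbours carry the factor J^(n-m), so \<open>len_ideal_mul_le\<close>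
    compares their quotient with the single quotient F(m+1) / J F(m). The condition m <= n keeps the
    truncated subtraction exact.\<close>
  have L_eq: "L m = ideal_mul J (n - m) (ideal_prod R J (F m))"
      "L (Suc m) = ideal_mul J (n - m) (F (Suc m))" if "m \<le> n" for m
    using that by (simp_all add: L_def Suc_diff_le ideal_mul_Suc_right)
  have L_step: "L m \<subseteq> L (Suc m)" if "m \<le> n" for m
    unfolding L_eq[OF that] by (rule ideal_mul_mono[OF F(2)])
  have L_0: "L 0 \<subseteq> L m" if "m \<le> Suc n" for m
    using that by (induction m) (use L_step in \<open>auto dest!: subsetD\<close>)
  have "len (L 0) (L m) = (\<Sum>i<m. len (L i) (L (Suc i)))" if "m \<le> Suc n" for m
    using that
  proof (induction m)
    case (Suc m)
    have "len (L 0) (L (Suc m)) = len (L 0) (L m) + len (L m) (L (Suc m))"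
      using Suc.prems by (intro len_add L_ideal L_0 L_step) auto
    then show ?case using Suc by simp
  qed (simp add: len_refl)
  from this[of "Suc n"] have "len (L 0) (L (Suc n)) = (\<Sum>m\<le>n. len (L m) (L (Suc m)))"
    by (simp add: lessThan_Suc_atMost)
  also have "\<dots> \<le> (\<Sum>m\<le>n. ?b * len (ideal_prod R J (F m)) (F (Suc m)))"
  proof (rule sum_mono)
    fix m assume "m \<in> {..n}"
    then have m: "m \<le> n" by simp
    have "len (L m) (L (Suc m)) \<le> of_nat (card (exponents (length xs) (n - m)))
        * len (ideal_prod R J (F m)) (F (Suc m))"
      unfolding L_eq[OF m]
      by (rule len_ideal_mul_le[OF xs J F(1) ideal_prod_is_ideal[OF J_ideal F(1)] F(2)])
    also have "\<dots> \<le> ?b * len (ideal_prod R J (F m)) (F (Suc m))"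
      using card_exponents_le[OF d, of "n - m" n]
      by (intro mult_right_mono) (simp_all add: of_nat_eq_enat)
    finally show "len (L m) (L (Suc m)) \<le> ?b * len (ideal_prod R J (F m)) (F (Suc m))" .
  qed
  finally show ?thesis by (simp add: L_def sum_distrib_left)
qed

lemma len_eq_0_imp_eq:
  assumes "ideal K R" "ideal I R" "K \<subseteq> I" "len K I = 0"
  shows "K = I"
proof (rule ccontr)
  assume "K \<noteq> I"
  then have "strict_chain (between K I) 1 (\<lambda>i. if i = 0 then K else I)"
    using assms by (auto simp: strict_chain_def between_def)
  then have "enat 1 \<le> len K I" unfolding len_def by (rule chain_sup_upper)
  then show False using assms(4) by (simp add: zero_enat_def)
qed

end

section \<open>The inequality for the first Hilbert coefficients\<close>

theorem corollary4p3:
  fixes R :: "('a, 'b) ring_scheme" and \<mm> J :: "'a set" and d :: nat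
    and A B :: "(nat \<Rightarrow> 'a) set"
  assumes "noetherian_local_ring R \<mm>"
    and "krull_dim R = enat d" and "d \<ge> 1"
    and "analytically_unramified R \<mm>"
    and "parameter_ideal R \<mm> J"
    and "A = rees_algebra R J"
    and "B = integral_rees_algebra R J"
    and "ideal_height ((UP R)\<lparr>carrier := A\<rparr>) (conductor (UP R) A B) = 1"
  shows "ereal (e1_bar R d J)
    \<le> (\<Sum>n. ereal_of_enat
          (quot_length R (integral_closure R (ideal_power R J (Suc n)))
             (ideal_prod R J (integral_closure R (ideal_power R J n)))))
      + ereal (e1 R d J)"
proof -
  have local: "maximalideal \<mm> R" "\<And>M. maximalideal M R \<Longrightarrow> M = \<mm>"
    using assms(1) by (auto simp: noetherian_local_ring_def)
  interpret noetherian_cring R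
    using assms(1) by (simp add: noetherian_local_ring_def noetherian_cring_def)
  obtain xs where xs_mm: "set xs \<subseteq> \<mm>" and len_xs: "length xs = d"
    and J: "J = genideal R (set xs)" and rad: "ideal_radical R J = \<mm>"
    using assms(2,5) by (auto simp: parameter_ideal_def system_of_parameters_def)
  have xs: "set xs \<subseteq> carrier R"
    using xs_mm ideal_subset[of \<mm>] local(1) by (auto simp: maximalideal_def)
  have J_ideal: "ideal J R" unfolding J by (rule genideal_ideal[OF xs])
  define F where "F n = integral_closure R (ideal_power R J n)" for n
  note pow_ideal = ideal_power_ideal[OF J_ideal]
  have F_ideal: "ideal (F n) R" for n
    unfolding F_def by (rule integral_closure_ideal[OF pow_ideal])
  have J_F: "ideal_prod R J (F n) \<subseteq> F (Suc n)" for n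
    unfolding F_def by (rule ideal_prod_integral_closure_power[OF J_ideal])
  have pow_F: "ideal_power R J n \<subseteq> F n" for n
    unfolding F_def by (rule subset_integral_closure[OF pow_ideal])
  have F_0: "F 0 = carrier R"
    using pow_F[of 0] ideal_subset[OF F_ideal] by auto
  define v where "v n = len (ideal_prod R J (F n)) (F (Suc n))" for n
  have v: "quot_length R (F (Suc n)) (ideal_prod R J (F n)) = v n" for n
    unfolding v_def
    by (rule quot_length_eq_len[OF ideal_prod_is_ideal[OF J_ideal F_ideal] F_ideal J_F])
  define S where "S = (\<Sum>n. ereal_of_enat (v n))"
  have "ereal (e1_bar R d J) \<le> S + ereal (e1 R d J)"
  \<comment> \<open>For an infinite sum the right-hand side is infinite, because \<open>e1\<close>
    is a real number; the work lies in the finite case.\<close>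
  proof (cases "S = \<infinity>")
    case False
    have partial: "(\<Sum>m<N. ereal_of_enat (v m)) \<le> S" for N
      unfolding S_def by (rule suminf_upper) (simp add: ereal_of_enat_nonneg)
    have "0 \<le> S" using partial[of 0] by simp
    then obtain s where s: "S = ereal s" using False by (cases S) auto
    have v_fin: "v n \<noteq> \<infinity>" for n
    proof
      assume "v n = \<infinity>"
      then have "(\<Sum>m<Suc n. ereal_of_enat (v m)) = \<infinity>"
        by (simp add: sum_Pinfty ereal_of_enat_nonneg)
      with partial[of "Suc n"] have "\<infinity> \<le> S" by (simp only:)
      then show False using False by simp
    qed
    define w where "w n = the_enat (v n)" for n
    have v_w: "v n = enat (w n)" for n using v_fin by (simp add: w_def enat_the_enat)
    have w_sum: "real (\<Sum>m<N. w m) \<le> s" for N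
      using partial[of N] by (simp add: v_w s)
    obtain k where k: "\<And>m. m \<ge> k \<Longrightarrow> w m = 0"
      using nat_partial_sums_bounded[OF w_sum] by blast
    \<comment> \<open>Only finitely many of the lengths are nonzero, and a quotient of length zero
      means equality; hence from \<open>k\<close> on each closure is \<open>J\<close> times the
      preceding one.\<close>
    have stable: "ideal_prod R J (F m) = F (Suc m)" if "m \<ge> k" for m
      using k[OF that] v_w[of m] J_F ideal_prod_is_ideal[OF J_ideal F_ideal]
      by (intro len_eq_0_imp_eq F_ideal) (simp_all add: v_def zero_enat_def)
    have F_k: "F (k + j) = ideal_mul J j (F k)" for j
    proof (induction j)
      case (Suc j)
      then show ?case using stable[of "k + j"] by (simp add: ideal_mul_Suc)
    qed simp

    have "len J (carrier R) \<noteq> \<infinity>"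
    proof (rule len_finite_of_radical[OF local(1) _ J_ideal])
      show "M = \<mm>" if "maximalideal M R" for M using that by (rule local(2))
    qed (simp add: rad)
    then have finJ: "len (ideal_prod R J (carrier R)) (carrier R) \<noteq> \<infinity>"
      by (simp add: ideal_prod_one[OF J_ideal])
    have pow_fin: "len (ideal_power R J n) (carrier R) \<noteq> \<infinity>" for n
      unfolding ideal_power_eq_ideal_mul by (rule hilbert_polynomial(2)[OF xs J oneideal finJ])
    have F_fin: "len (F n) (carrier R) \<noteq> \<infinity>" for n
      using len_mono[OF pow_F subset_refl, of n "carrier R"] pow_fin[of n]
      by (cases "len (F n) (carrier R)") auto
    \<comment> \<open>J F(k) equals F(k+1), which contains a power of \<open>J\<close> and so has
      finite colength.\<close>
    have "len (ideal_prod R J (F k)) (F k) \<le> len (F (Suc k)) (carrier R)"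
      using F_k[of 1] ideal_subset[OF F_ideal] by (intro len_mono) (auto simp: ideal_mul_Suc)
    then have fink: "len (ideal_prod R J (F k)) (F k) \<noteq> \<infinity>"
      using F_fin[of "Suc k"] by (cases "len (ideal_prod R J (F k)) (F k)") auto

    have P: "ev_binomial (Suc d) (\<lambda>n. rlen (ideal_power R J (n + 1)) (carrier R))"
      using hilbert_polynomial(1)[OF xs J oneideal finJ]
      by (simp add: ideal_power_eq_ideal_mul len_xs del: ideal_power.simps)
    \<comment> \<open>The Hilbert function of the closures is that of the ideal F(k), delayed by
      \<open>k\<close>, plus the constant colength of F(k).\<close>
    have "rlen (F (n + 1)) (carrier R)
        = rlen (ideal_mul J (Suc (n - k)) (F k)) (F k) + rlen (F k) (carrier R)" if "n \<ge> k" for n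
    proof -
      have F_n: "F (n + 1) = ideal_mul J (Suc (n - k)) (F k)"
        using F_k[of "Suc (n - k)"] that by simp
      have "len (F (n + 1)) (carrier R)
          = len (ideal_mul J (Suc (n - k)) (F k)) (F k) + len (F k) (carrier R)"
        unfolding F_n
        using ideal_mul_antimono[OF J_ideal F_ideal, of 0 "Suc (n - k)" k] ideal_subset[OF F_ideal]
        by (intro len_add ideal_mul_ideal J_ideal F_ideal oneideal) auto
      moreover obtain p q where "len (ideal_mul J (Suc (n - k)) (F k)) (F k) = enat p"
          "len (F k) (carrier R) = enat q"
        using hilbert_polynomial(2)[OF xs J F_ideal fink, of "Suc (n - k)"] F_fin[of k] by auto
      ultimately show ?thesis by (simp add: rlen_def)
    qed
    then have "\<forall>\<^sub>F n in sequentially. rlen (F (n + 1)) (carrier R)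
        = rlen (ideal_mul J (Suc (n - k)) (F k)) (F k) + rlen (F k) (carrier R)"
      unfolding eventually_sequentially by blast
    moreover have "ev_binomial (Suc d)
        (\<lambda>n. rlen (ideal_mul J (Suc (n - k)) (F k)) (F k) + rlen (F k) (carrier R))"
      using ev_binomial_diff_nat[OF hilbert_polynomial(1)[OF xs J F_ideal fink], of k]
      by (intro ev_binomial_add ev_binomial_const) (simp_all add: len_xs)
    ultimately have P_bar: "ev_binomial (Suc d) (\<lambda>n. rlen (F (n + 1)) (carrier R))"
      by (blast intro: ev_binomial_cong)

    obtain c where c: "\<forall>\<^sub>F n in sequentially. rlen (ideal_power R J (n + 1)) (carrier R)
        = (\<Sum>i<Suc d. c i * real ((n + i) choose i))"
      using P unfolding ev_binomial_def by blast
    obtain c' where c': "\<forall>\<^sub>F n in sequentially. rlen (F (n + 1)) (carrier R)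
        = (\<Sum>i<Suc d. c' i * real ((n + i) choose i))"
      using P_bar unfolding ev_binomial_def by blast
    have ql: "ereal_of_enat (quot_length R (carrier R) K) = ereal (rlen K (carrier R))"
      if "ideal K R" "len K (carrier R) \<noteq> \<infinity>" for K
      using that(2) quot_length_eq_len[OF that(1) oneideal ideal_subset[OF that(1)]]
      by (auto simp: rlen_def)
    have e1: "e1 R d J = - c (d - 1)"
      unfolding e1_def
    proof (rule binomial_coeffs_eventual_poly[OF _ assms(3)])
      show "\<forall>\<^sub>F n in sequentially. ereal_of_enat (quot_length R (carrier R) (ideal_power R J (n + 1)))
          = ereal (\<Sum>i<Suc d. c i * real ((n + i) choose i))"
        using c by eventually_elim (simp only: ql[OF pow_ideal pow_fin])
    qed
    have e1_bar: "e1_bar R d J = - c' (d - 1)"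
      unfolding e1_bar_def F_def[symmetric]
    proof (rule binomial_coeffs_eventual_poly[OF _ assms(3)])
      show "\<forall>\<^sub>F n in sequentially. ereal_of_enat (quot_length R (carrier R) (F (n + 1)))
          = ereal (\<Sum>i<Suc d. c' i * real ((n + i) choose i))"
        using c' by eventually_elim (simp only: ql[OF F_ideal F_fin])
    qed

    let ?b = "\<lambda>n. (n + (d - 1)) choose (d - 1)"
    have bounds: "rlen (F (n + 1)) (carrier R) \<le> rlen (ideal_power R J (n + 1)) (carrier R)"
      "rlen (ideal_power R J (n + 1)) (carrier R) \<le> rlen (F (n + 1)) (carrier R) + s * real (?b n)"
      for n
    proof -
      let ?I = "ideal_power R J (n + 1)"
      have I: "?I = ideal_mul J (Suc n) (F 0)"
        by (simp only: ideal_power_eq_ideal_mul F_0 Suc_eq_plus1)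
      \<comment> \<open>The difference of the two colengths is the length of F(n+1) / J^(n+1). This
        gives both bounds: it is nonnegative, and the chain of closures estimates it from
        above.\<close>
      have add: "len ?I (carrier R) = len ?I (F (n + 1)) + len (F (n + 1)) (carrier R)"
        by (rule len_add[OF pow_ideal F_ideal oneideal pow_F ideal_subset[OF F_ideal]])
      then obtain p q where pq: "len ?I (F (n + 1)) = enat p" "len (F (n + 1)) (carrier R) = enat q"
        using pow_fin[of "n + 1"] by (auto simp: plus_eq_infty_iff_enat)
      have "len ?I (F (n + 1)) \<le> of_nat (?b n) * (\<Sum>m\<le>n. v m)"
        unfolding I v_def
        using len_filtration_le[where F = F and n = n, OF xs J _ F_ideal J_F] assms(3)
        by (simp only: len_xs Suc_eq_plus1 simp_thms)
      also have "(\<Sum>m\<le>n. v m) = enat (\<Sum>m\<le>n. w m)"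
        by (simp add: v_w of_nat_eq_enat[symmetric])
      finally have "enat p \<le> of_nat (?b n) * enat (\<Sum>m\<le>n. w m)" by (simp only: pq)
      then have "p \<le> ?b n * (\<Sum>m\<le>n. w m)" by (simp add: of_nat_eq_enat)
      then have "real p \<le> real (?b n) * real (\<Sum>m\<le>n. w m)" by (metis of_nat_le_iff of_nat_mult)
      also have "\<dots> \<le> real (?b n) * s"
        using w_sum[of "Suc n"] by (intro mult_left_mono) (simp_all add: lessThan_Suc_atMost)
      finally have "real p \<le> s * real (?b n)" by (simp add: mult.commute)
      moreover have "rlen ?I (carrier R) = real p + real q" "rlen (F (n + 1)) (carrier R) = real q"
        unfolding rlen_def add unfolding pq by simp_all
      ultimately show "rlen (F (n + 1)) (carrier R) \<le> rlen ?I (carrier R)"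
        "rlen ?I (carrier R) \<le> rlen (F (n + 1)) (carrier R) + s * real (?b n)" by simp_all
    qed
    have "c (d - 1) \<le> s + c' (d - 1)"
    proof (rule second_coeff_le[OF assms(3)])
      show "\<forall>\<^sub>F n in sequentially. (\<Sum>i<Suc d. c' i * real ((n + i) choose i))
          \<le> (\<Sum>i<Suc d. c i * real ((n + i) choose i))"
        using c c' by eventually_elim (use bounds(1) in metis)
      show "\<forall>\<^sub>F n in sequentially. (\<Sum>i<Suc d. c i * real ((n + i) choose i))
          \<le> (\<Sum>i<Suc d. c' i * real ((n + i) choose i)) + s * real (?b n)"
        using c c' by eventually_elim (use bounds(2) in metis)
    qed
    then show ?thesis by (simp add: e1 e1_bar s)
  qed simp
  then show ?thesis unfolding S_def v[symmetric] F_def .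
qed

end
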